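(* Let $G$ be a triangle-free subdivision of $K_4$. Then $G$ is a restricted frame graph if and only if either (1) $G$ is obtained from $K_4$ by subdividing at most $3$ of its $6$ edges, or (2) $G$ is obtained from $K_4$ by subdividing exactly $4$ of its edges and the two non-subdivided edges share a vertex.
   Context: A subdivision of $K_4$ is obtained by replacing each edge of $K_4$ by a path; an edge is subdivided if its path has at least two edges. A frame is the boundary of an axis-parallel box $I\times J\subset\mathbb R^2$. A graph $G$ is a restricted frame graph if there is a family of frames $\{F_v : v\in V(G)\}$ with $uv\in E(G)$ iff $F_u\cap F_v\neq\emptyset$, satisfying: (1) corners of a frame do not coincide with any point of another frame; (2) the left side of any frame does not intersect any other frame; (3) if the right side of a frame intersects a second frame, this right side intersects both the top and the bottom side of the second frame; (4) if two frames have non-empty intersection, then no frame is entirely contained in the intersection of the two regions bounded by these two frames. *)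

theory Defs
  imports Main "HOL.Real"
begin

definition simple_graph :: "'a set \<Rightarrow> ('a \<Rightarrow> 'a \<Rightarrow> bool) \<Rightarrow> bool" where
  "simple_graph V E \<longleftrightarrow> finite V \<and>
     (\<forall>u v. E u v \<longrightarrow> u \<in> V \<and> v \<in> V \<and> u \<noteq> v \<and> E v u)"

definition triangle_free :: "'a set \<Rightarrow> ('a \<Rightarrow> 'a \<Rightarrow> bool) \<Rightarrow> bool" where
  "triangle_free V E \<longleftrightarrow> \<not> (\<exists>u\<in>V. \<exists>v\<in>V. \<exists>w\<in>V. E u v \<and> E v w \<and> E u w)"

definition k4_pairs :: "(nat \<times> nat) set" where
  "k4_pairs = {(i, j). i < j \<and> j < 4}"

definition interior :: "'a list \<Rightarrow> 'a set" where
  "interior p = set (butlast (tl p))"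

definition k4_subdivision_wit ::
  "'a set \<Rightarrow> ('a \<Rightarrow> 'a \<Rightarrow> bool) \<Rightarrow> (nat \<Rightarrow> 'a) \<Rightarrow> (nat \<Rightarrow> nat \<Rightarrow> 'a list) \<Rightarrow> bool" where
  "k4_subdivision_wit V E b P \<longleftrightarrow>
     inj_on b {0..<4} \<and>
     (\<forall>(i, j) \<in> k4_pairs. distinct (P i j) \<and> 2 \<le> length (P i j) \<and>
         hd (P i j) = b i \<and> last (P i j) = b j \<and>
         interior (P i j) \<inter> b ` {0..<4} = {}) \<and>
     (\<forall>(i, j) \<in> k4_pairs. \<forall>(k, l) \<in> k4_pairs. (i, j) \<noteq> (k, l) \<longrightarrow>
         interior (P i j) \<inter> set (P k l) = {}) \<and>
     V = (\<Union>(i, j) \<in> k4_pairs. set (P i j)) \<and>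
     (\<forall>u v. E u v \<longleftrightarrow>
        (\<exists>(i, j) \<in> k4_pairs. \<exists>k. Suc k < length (P i j) \<and>
            ((u = P i j ! k \<and> v = P i j ! Suc k) \<or> (v = P i j ! k \<and> u = P i j ! Suc k))))"

definition k4_subdivision :: "'a set \<Rightarrow> ('a \<Rightarrow> 'a \<Rightarrow> bool) \<Rightarrow> bool" where
  "k4_subdivision V E \<longleftrightarrow> (\<exists>b P. k4_subdivision_wit V E b P)"

definition subdivided_pairs :: "(nat \<Rightarrow> nat \<Rightarrow> 'a list) \<Rightarrow> (nat \<times> nat) set" where
  "subdivided_pairs P = {(i, j) \<in> k4_pairs. 3 \<le> length (P i j)}"

text \<open>A frame is the boundary of the box [xl,xr] \<times> [yb,yt] with xl < xr and yb < yt.\<close>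
record frame =
  xl :: real
  xr :: real
  yb :: real
  yt :: real

definition frame_ok :: "frame \<Rightarrow> bool" where
  "frame_ok f \<longleftrightarrow> xl f < xr f \<and> yb f < yt f"

definition region :: "frame \<Rightarrow> (real \<times> real) set" where
  "region f = {(x, y). xl f \<le> x \<and> x \<le> xr f \<and> yb f \<le> y \<and> y \<le> yt f}"

definition left_side :: "frame \<Rightarrow> (real \<times> real) set" where
  "left_side f = {(x, y). x = xl f \<and> yb f \<le> y \<and> y \<le> yt f}"

definition right_side :: "frame \<Rightarrow> (real \<times> real) set" where
  "right_side f = {(x, y). x = xr f \<and> yb f \<le> y \<and> y \<le> yt f}"

definition bottom_side :: "frame \<Rightarrow> (real \<times> real) set" where
  "bottom_side f = {(x, y). y = yb f \<and> xl f \<le> x \<and> x \<le> xr f}"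

definition top_side :: "frame \<Rightarrow> (real \<times> real) set" where
  "top_side f = {(x, y). y = yt f \<and> xl f \<le> x \<and> x \<le> xr f}"

definition frame_pts :: "frame \<Rightarrow> (real \<times> real) set" where
  "frame_pts f = left_side f \<union> right_side f \<union> bottom_side f \<union> top_side f"

definition corners :: "frame \<Rightarrow> (real \<times> real) set" where
  "corners f = {(xl f, yb f), (xl f, yt f), (xr f, yb f), (xr f, yt f)}"

definition restricted_frame_graph :: "'a set \<Rightarrow> ('a \<Rightarrow> 'a \<Rightarrow> bool) \<Rightarrow> bool" where
  "restricted_frame_graph V E \<longleftrightarrow> (\<exists>F :: 'a \<Rightarrow> frame.
     (\<forall>v\<in>V. frame_ok (F v)) \<and>
     (\<forall>u\<in>V. \<forall>v\<in>V. u \<noteq> v \<longrightarrow> (E u v \<longleftrightarrow> frame_pts (F u) \<inter> frame_pts (F v) \<noteq> {})) \<and>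
     \<comment> \<open>(1) corners of a frame avoid every other frame\<close>
     (\<forall>u\<in>V. \<forall>v\<in>V. u \<noteq> v \<longrightarrow> corners (F u) \<inter> frame_pts (F v) = {}) \<and>
     \<comment> \<open>(2) the left side of a frame meets no other frame\<close>
     (\<forall>u\<in>V. \<forall>v\<in>V. u \<noteq> v \<longrightarrow> left_side (F u) \<inter> frame_pts (F v) = {}) \<and>
     \<comment> \<open>(3) a right side meeting another frame meets its top and bottom sides\<close>
     (\<forall>u\<in>V. \<forall>v\<in>V. u \<noteq> v \<longrightarrow> right_side (F u) \<inter> frame_pts (F v) \<noteq> {} \<longrightarrow>
        right_side (F u) \<inter> top_side (F v) \<noteq> {} \<and> right_side (F u) \<inter> bottom_side (F v) \<noteq> {}) \<and>
     \<comment> \<open>(4) no frame lies in the intersection of the regions of two intersecting frames\<close>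
     (\<forall>u\<in>V. \<forall>v\<in>V. u \<noteq> v \<longrightarrow> frame_pts (F u) \<inter> frame_pts (F v) \<noteq> {} \<longrightarrow>
        (\<forall>w\<in>V. \<not> frame_pts (F w) \<subseteq> region (F u) \<inter> region (F v))))"

end

theory Submission
  imports Defs
begin

text \<open>
  If two frames meet, then one of them starts inside the other and leaves it through the right side
  (``pokes''); the poking frame is strictly less high. If they do not meet, they are nested or apart.

  Suppose that no two unsubdivided edges share a branch vertex. Then deleting any closed neighbourhood
  leaves a connected graph, so a frame that contains some frame contains all frames that do not meet
  it. Two such frames would violate condition (4), hence there is at most one, say \<open>s\<close>. Some cycle
  avoids \<open>s\<close>, and the least high frame on it pokes both its neighbours on the cycle. These contain a
  common point and do not meet, so they are nested, and the outer one must be \<open>s\<close>: contradiction.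

  Conversely let the edges \<open>ac\<close> and \<open>ad\<close> be unsubdivided and let \<open>e\<close> be the fourth branch vertex. From
  the frame of \<open>e\<close> three chains of frames grow to the right, each poking its predecessor, along the
  paths to \<open>c\<close>, \<open>d\<close> and \<open>a\<close>. The frame of \<open>a\<close> surrounds them, and \<open>c\<close>, \<open>d\<close> and the last frame of the
  third chain poke it; if \<open>ea\<close> is an edge, then \<open>a\<close> pokes \<open>e\<close> instead. The neighbour of \<open>c\<close> on the
  path from \<open>c\<close> to \<open>d\<close> surrounds everything; \<open>c\<close> pokes it, and so does the last frame of the chain
  that continues from \<open>d\<close> along this path.
\<close>

section \<open>Relative position of two frames\<close>

definition pokes :: "frame \<Rightarrow> frame \<Rightarrow> bool" where
  "pokes f g \<longleftrightarrow> xl g < xl f \<and> xl f < xr g \<and> xr g < xr f \<and> yb g < yb f \<and> yt f < yt g"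

definition inside :: "frame \<Rightarrow> frame \<Rightarrow> bool" where
  "inside f g \<longleftrightarrow> xl g < xl f \<and> xr f < xr g \<and> yb g < yb f \<and> yt f < yt g"

definition apart :: "frame \<Rightarrow> frame \<Rightarrow> bool" where
  "apart f g \<longleftrightarrow> xr f < xl g \<or> xr g < xl f \<or> yt f < yb g \<or> yt g < yb f"

lemmas side_defs = frame_pts_def left_side_def right_side_def bottom_side_def top_side_def

lemma mem_frame_pts_iff:
  "(x, y) \<in> frame_pts f \<longleftrightarrow>
    (x = xl f \<or> x = xr f) \<and> yb f \<le> y \<and> y \<le> yt f \<or>
    (y = yb f \<or> y = yt f) \<and> xl f \<le> x \<and> x \<le> xr f"
  by (auto simp: side_defs)

text \<open>If the frames overlap and \<open>g\<close> starts no further right than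
  \<open>f\<close>, each inequality of \<open>inside f g\<close> can fail only by putting one
  explicit point on both frames. The other order follows by symmetry.\<close>

lemma disjoint_frames_cases:
  assumes "frame_ok f" "frame_ok g" "frame_pts f \<inter> frame_pts g = {}"
  shows "inside f g \<or> inside g f \<or> apart f g"
proof -
  have nested: "inside f g"
    if ok: "frame_ok f" "frame_ok g" and disj: "frame_pts f \<inter> frame_pts g = {}"
      and "\<not> apart f g" "xl g \<le> xl f" for f g
  proof -
    have D: "\<not> ((x, y) \<in> frame_pts f \<and> (x, y) \<in> frame_pts g)" for x y
      using disj by blast
    have overlap: "xl f \<le> xr g" "yb g \<le> yt f" "yb f \<le> yt g" "xl f < xr f" "xl g < xr g"
        "yb f < yt f" "yb g < yt g"
      using that by (auto simp: apart_def frame_ok_def)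
    have "yb g < yb f"
      using D[of "xl f" "yb g"] that(5) overlap by (auto simp: mem_frame_pts_iff)
    moreover have "yt f < yt g"
      using D[of "xl f" "yt g"] that(5) overlap by (auto simp: mem_frame_pts_iff)
    moreover have "xl g < xl f"
      using D[of "xl g" "yb f"] that(5) overlap calculation by (auto simp: mem_frame_pts_iff)
    moreover have "xr f < xr g"
      using D[of "xr g" "yb f"] that(5) overlap calculation by (auto simp: mem_frame_pts_iff)
    ultimately show ?thesis
      by (simp add: inside_def)
  qed
  show ?thesis
  proof (cases "xl g \<le> xl f")
    case True
    then show ?thesis
      using nested assms by blast
  next
    case False
    moreover have "apart g f \<longleftrightarrow> apart f g"
      by (auto simp: apart_def)
    ultimately show ?thesis
      using nested[of g f] assms by (auto simp: Int_commute)
  qed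
qed

text \<open>The crossings with top and bottom give weak inequalities. Condition (1) at four corners
  makes them strict; condition (2), at the point \<open>(xl f, yb g)\<close>, forces
  \<open>xl f < xl g\<close>.\<close>

lemma right_side_meets_imp_pokes:
  assumes ok: "frame_ok f" "frame_ok g"
    and corners: "corners f \<inter> frame_pts g = {}" "corners g \<inter> frame_pts f = {}"
    and left: "left_side f \<inter> frame_pts g = {}"
    and meets: "right_side f \<inter> top_side g \<noteq> {}" "right_side f \<inter> bottom_side g \<noteq> {}"
  shows "pokes g f"
proof -
  have "xl g \<le> xr f" "xr f \<le> xr g" "yb f \<le> yb g" "yt g \<le> yt f"
    using meets by (auto simp: side_defs)
  moreover have "(xr f, yb f) \<notin> frame_pts g" "(xr f, yt f) \<notin> frame_pts g"
    "(xr g, yb g) \<notin> frame_pts f" "(xl g, yb g) \<notin> frame_pts f" "(xl f, yb g) \<notin> frame_pts g"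
    using corners left calculation ok
    by (auto simp: corners_def left_side_def frame_ok_def disjoint_iff)
  ultimately show ?thesis
    using ok by (auto simp: mem_frame_pts_iff pokes_def frame_ok_def)
qed

text \<open>If a right side is met, condition (3) provides the crossings that lead to poking.
  Otherwise the left and right sides are all free, and only horizontal sides could touch.\<close>

lemma meeting_frames_cases:
  assumes ok: "frame_ok f" "frame_ok g"
    and corners: "corners f \<inter> frame_pts g = {}" "corners g \<inter> frame_pts f = {}"
    and left: "left_side f \<inter> frame_pts g = {}" "left_side g \<inter> frame_pts f = {}"
    and right: "right_side f \<inter> frame_pts g \<noteq> {} \<Longrightarrow>
        right_side f \<inter> top_side g \<noteq> {} \<and> right_side f \<inter> bottom_side g \<noteq> {}"
      "right_side g \<inter> frame_pts f \<noteq> {} \<Longrightarrow>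
        right_side g \<inter> top_side f \<noteq> {} \<and> right_side g \<inter> bottom_side f \<noteq> {}"
    and meet: "frame_pts f \<inter> frame_pts g \<noteq> {}"
  shows "pokes f g \<or> pokes g f"
proof (cases "right_side f \<inter> frame_pts g = {} \<and> right_side g \<inter> frame_pts f = {}")
  case True
  obtain x y where xy: "(x, y) \<in> frame_pts f" "(x, y) \<in> frame_pts g"
    using meet by auto
  have "(x, y) \<in> bottom_side f \<union> top_side f" "(x, y) \<in> bottom_side g \<union> top_side g"
    using True left xy unfolding frame_pts_def by auto
  then have *: "y = yb f \<or> y = yt f" "xl f \<le> x" "x \<le> xr f"
    "y = yb g \<or> y = yt g" "xl g \<le> x" "x \<le> xr g"
    by (auto simp: bottom_side_def top_side_def)
  \<comment> \<open>Both frames have a horizontal side at height \<open>y\<close> through the common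
    point, so whichever of these two corners is further right lies on the other frame, against
    condition (1).\<close>
  have "(xl f, y) \<in> corners f" "(xl g, y) \<in> corners g"
    using * by (auto simp: corners_def)
  then have "(xl f, y) \<notin> frame_pts g" "(xl g, y) \<notin> frame_pts f"
    using corners by auto
  with * show ?thesis
    unfolding frame_pts_def bottom_side_def top_side_def by auto
next
  case False
  then show ?thesis
    using right_side_meets_imp_pokes[of f g] right_side_meets_imp_pokes[of g f] assms by blast
qed

lemma apart_or_nested_imp_disjoint:
  assumes "frame_ok f" "frame_ok g" "inside f g \<or> inside g f \<or> apart f g"
  shows "frame_pts f \<inter> frame_pts g = {}"
  using assms by (auto simp: mem_frame_pts_iff inside_def apart_def frame_ok_def)

lemma pokes_imp_frame_conditions:
  assumes "frame_ok f" "frame_ok g" "pokes f g"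
  shows "frame_pts f \<inter> frame_pts g \<noteq> {}"
    and "left_side f \<inter> frame_pts g = {}" "left_side g \<inter> frame_pts f = {}"
    and "corners f \<inter> frame_pts g = {}" "corners g \<inter> frame_pts f = {}"
    and "right_side f \<inter> frame_pts g = {}"
    and "right_side g \<inter> top_side f \<noteq> {}" "right_side g \<inter> bottom_side f \<noteq> {}"
proof -
  have *: "(xr g, yt f) \<in> right_side g \<inter> top_side f" "(xr g, yb f) \<in> right_side g \<inter> bottom_side f"
    using assms by (auto simp: side_defs pokes_def frame_ok_def)
  then show "right_side g \<inter> top_side f \<noteq> {}" "right_side g \<inter> bottom_side f \<noteq> {}"
    by blast+
  show "frame_pts f \<inter> frame_pts g \<noteq> {}"
    using * by (auto simp: frame_pts_def)
qed (use assms in \<open>auto simp: side_defs corners_def pokes_def frame_ok_def\<close>)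

lemma frame_pts_subset_region_iff:
  assumes "frame_ok f"
  shows "frame_pts f \<subseteq> region g \<longleftrightarrow>
    xl g \<le> xl f \<and> xr f \<le> xr g \<and> yb g \<le> yb f \<and> yt f \<le> yt g"
proof
  assume "frame_pts f \<subseteq> region g"
  moreover have "(xl f, yb f) \<in> frame_pts f" "(xr f, yt f) \<in> frame_pts f"
    using assms by (auto simp: side_defs frame_ok_def)
  ultimately show "xl g \<le> xl f \<and> xr f \<le> xr g \<and> yb g \<le> yb f \<and> yt f \<le> yt g"
    by (auto simp: region_def)
qed (use assms in \<open>auto simp: side_defs region_def frame_ok_def\<close>)

section \<open>Restricted frame graphs in terms of relative positions\<close>

text \<open>This is the interface for the necessity proof: the geometry is reduced to poking,
  nesting and separation, and condition (4) is kept only for frames strictly inside both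
  others.\<close>

lemma restricted_frame_graphD:
  assumes "restricted_frame_graph V E"
  obtains F :: "'a \<Rightarrow> frame" where
    "\<And>v. v \<in> V \<Longrightarrow> frame_ok (F v)"
    "\<And>u v. \<lbrakk>u \<in> V; v \<in> V; u \<noteq> v; E u v\<rbrakk> \<Longrightarrow> pokes (F u) (F v) \<or> pokes (F v) (F u)"
    "\<And>u v. \<lbrakk>u \<in> V; v \<in> V; u \<noteq> v; \<not> E u v\<rbrakk> \<Longrightarrow>
        inside (F u) (F v) \<or> inside (F v) (F u) \<or> apart (F u) (F v)"
    "\<And>u v w. \<lbrakk>u \<in> V; v \<in> V; w \<in> V; u \<noteq> v; E u v\<rbrakk> \<Longrightarrow> \<not> (inside (F w) (F u) \<and> inside (F w) (F v))"
proof -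
  obtain F :: "'a \<Rightarrow> frame" where
    ok: "\<forall>v\<in>V. frame_ok (F v)" and
    adj: "\<forall>u\<in>V. \<forall>v\<in>V. u \<noteq> v \<longrightarrow> (E u v \<longleftrightarrow> frame_pts (F u) \<inter> frame_pts (F v) \<noteq> {})" and
    cor: "\<forall>u\<in>V. \<forall>v\<in>V. u \<noteq> v \<longrightarrow> corners (F u) \<inter> frame_pts (F v) = {}" and
    lft: "\<forall>u\<in>V. \<forall>v\<in>V. u \<noteq> v \<longrightarrow> left_side (F u) \<inter> frame_pts (F v) = {}" and
    rgt: "\<forall>u\<in>V. \<forall>v\<in>V. u \<noteq> v \<longrightarrow> right_side (F u) \<inter> frame_pts (F v) \<noteq> {} \<longrightarrow>
        right_side (F u) \<inter> top_side (F v) \<noteq> {} \<and> right_side (F u) \<inter> bottom_side (F v) \<noteq> {}" and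
    four: "\<forall>u\<in>V. \<forall>v\<in>V. u \<noteq> v \<longrightarrow> frame_pts (F u) \<inter> frame_pts (F v) \<noteq> {} \<longrightarrow>
        (\<forall>w\<in>V. \<not> frame_pts (F w) \<subseteq> region (F u) \<inter> region (F v))"
    using assms unfolding restricted_frame_graph_def by (elim exE conjE) (rule that)
  show thesis
  proof (rule that[of F])
    show "frame_ok (F v)" if "v \<in> V" for v
      using ok that by blast
    show "pokes (F u) (F v) \<or> pokes (F v) (F u)" if "u \<in> V" "v \<in> V" "u \<noteq> v" "E u v" for u v
      using ok adj cor lft rgt that by (intro meeting_frames_cases) (simp_all del: ex_in_conv)
    show "inside (F u) (F v) \<or> inside (F v) (F u) \<or> apart (F u) (F v)"
      if "u \<in> V" "v \<in> V" "u \<noteq> v" "\<not> E u v" for u v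
      using disjoint_frames_cases[of "F u" "F v"] ok adj that by simp
    show "\<not> (inside (F w) (F u) \<and> inside (F w) (F v))"
      if "u \<in> V" "v \<in> V" "w \<in> V" "u \<noteq> v" "E u v" for u v w
    proof
      assume "inside (F w) (F u) \<and> inside (F w) (F v)"
      then have "frame_pts (F w) \<subseteq> region (F u) \<inter> region (F v)"
        using ok that by (simp add: frame_pts_subset_region_iff inside_def)
      then show False
        using four adj that by blast
    qed
  qed
qed

text \<open>Of two meeting frames one pokes the other, so condition (4) need only be checked with
  \<open>v\<close> poking \<open>u\<close>. A frame \<open>w\<close> in both regions would be inside
  \<open>v\<close> and end no later than \<open>u\<close>, which \<open>four\<close>
  excludes.\<close>

lemma restricted_frame_graphI:
  fixes F :: "'a \<Rightarrow> frame"
  assumes sym: "\<And>u v. E u v \<Longrightarrow> E v u"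
    and ok: "\<And>v. v \<in> V \<Longrightarrow> frame_ok (F v)"
    and adj: "\<And>u v. \<lbrakk>u \<in> V; v \<in> V; E u v\<rbrakk> \<Longrightarrow> pokes (F u) (F v) \<or> pokes (F v) (F u)"
    and nonadj: "\<And>u v. \<lbrakk>u \<in> V; v \<in> V; u \<noteq> v; \<not> E u v\<rbrakk> \<Longrightarrow>
        inside (F u) (F v) \<or> inside (F v) (F u) \<or> apart (F u) (F v)"
    and four: "\<And>u v w. \<lbrakk>u \<in> V; v \<in> V; w \<in> V; w \<noteq> u; pokes (F v) (F u); inside (F w) (F v)\<rbrakk>
        \<Longrightarrow> xr (F u) < xr (F w)"
  shows "restricted_frame_graph V E"
proof -
  have pair: "E u v \<longleftrightarrow> frame_pts (F u) \<inter> frame_pts (F v) \<noteq> {}"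
    "corners (F u) \<inter> frame_pts (F v) = {}" "left_side (F u) \<inter> frame_pts (F v) = {}"
    "right_side (F u) \<inter> frame_pts (F v) \<noteq> {} \<Longrightarrow>
      right_side (F u) \<inter> top_side (F v) \<noteq> {} \<and> right_side (F u) \<inter> bottom_side (F v) \<noteq> {}"
    if uv: "u \<in> V" "v \<in> V" "u \<noteq> v" for u v
  proof -
    have sub: "corners f \<subseteq> frame_pts f" "left_side f \<subseteq> frame_pts f" "right_side f \<subseteq> frame_pts f"
      if "frame_ok f" for f
      using that by (auto simp: side_defs corners_def frame_ok_def)
    consider "E u v" "pokes (F u) (F v)" | "E u v" "pokes (F v) (F u)"
      | "\<not> E u v" "frame_pts (F u) \<inter> frame_pts (F v) = {}"
      using adj[OF uv(1,2)] nonadj[OF uv] apart_or_nested_imp_disjoint[OF ok[OF uv(1)] ok[OF uv(2)]]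
      by blast
    then have "(E u v \<longleftrightarrow> frame_pts (F u) \<inter> frame_pts (F v) \<noteq> {}) \<and>
      corners (F u) \<inter> frame_pts (F v) = {} \<and> left_side (F u) \<inter> frame_pts (F v) = {} \<and>
      (right_side (F u) \<inter> frame_pts (F v) \<noteq> {} \<longrightarrow>
      right_side (F u) \<inter> top_side (F v) \<noteq> {} \<and> right_side (F u) \<inter> bottom_side (F v) \<noteq> {})"
    proof cases
      case 1
      then show ?thesis
        using pokes_imp_frame_conditions[OF ok ok] uv by simp
    next
      case 2
      then show ?thesis
        using pokes_imp_frame_conditions[OF ok ok, of v u] uv by (simp add: Int_commute)
    next
      case 3
      then show ?thesis
        using sub[OF ok[OF uv(1)]] by blast
    qed
    then show "E u v \<longleftrightarrow> frame_pts (F u) \<inter> frame_pts (F v) \<noteq> {}"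
      "corners (F u) \<inter> frame_pts (F v) = {}" "left_side (F u) \<inter> frame_pts (F v) = {}"
      "right_side (F u) \<inter> frame_pts (F v) \<noteq> {} \<Longrightarrow>
      right_side (F u) \<inter> top_side (F v) \<noteq> {} \<and> right_side (F u) \<inter> bottom_side (F v) \<noteq> {}"
      by blast+
  qed
  have no_common: "\<not> frame_pts (F w) \<subseteq> region (F u) \<inter> region (F v)"
    if "u \<in> V" "v \<in> V" "w \<in> V" "pokes (F v) (F u)" for u v w
  proof
    assume "frame_pts (F w) \<subseteq> region (F u) \<inter> region (F v)"
    then have sub: "xl (F u) \<le> xl (F w)" "xr (F w) \<le> xr (F u)" "xl (F v) \<le> xl (F w)"
      "xr (F w) \<le> xr (F v)" "yb (F v) \<le> yb (F w)" "yt (F w) \<le> yt (F v)"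
      using ok that by (auto simp: frame_pts_subset_region_iff)
    have ne: "w \<noteq> u" "w \<noteq> v"
      using sub that(4) by (auto simp: pokes_def)
    \<comment> \<open>Containment of \<open>w\<close> in the region of \<open>v\<close> excludes
      poking in either direction, being apart, and \<open>v\<close> inside \<open>w\<close>.\<close>
    have "inside (F w) (F v)"
      using adj[of w v] nonadj[of w v] that ne sub ok[OF that(3)]
      unfolding pokes_def inside_def apart_def frame_ok_def by argo
    then show False
      using four[OF that(1-3) ne(1) that(4)] sub by simp
  qed
  have four': "\<not> frame_pts (F w) \<subseteq> region (F u) \<inter> region (F v)"
    if "u \<in> V" "v \<in> V" "w \<in> V" "u \<noteq> v" "frame_pts (F u) \<inter> frame_pts (F v) \<noteq> {}" for u v w
  proof -
    have "E u v"
      using pair(1) that by blast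
    then show ?thesis
      using adj[of u v] no_common[of u v w] no_common[of v u w] that by blast
  qed
  show ?thesis
    unfolding restricted_frame_graph_def
    by (intro exI[of _ F] conjI ballI impI;
        (rule ok pair four' pair(4)[THEN conjunct1] pair(4)[THEN conjunct2]; assumption))
qed

section \<open>Subdivisions of \<open>K\<^sub>4\<close>\<close>

text \<open>
  \<open>pt i j k\<close> is the \<open>k\<close>-th vertex on the path from \<open>b i\<close> to \<open>b j\<close>, for both orders of \<open>i\<close> and \<open>j\<close>, and
  \<open>len i j\<close> is its number of edges.
\<close>

locale k4_paths =
  fixes V :: "'a set" and E :: "'a \<Rightarrow> 'a \<Rightarrow> bool" and b :: "nat \<Rightarrow> 'a"
    and len :: "nat \<Rightarrow> nat \<Rightarrow> nat" and pt :: "nat \<Rightarrow> nat \<Rightarrow> nat \<Rightarrow> 'a"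
  assumes b_inj: "\<lbrakk>i < 4; j < 4; b i = b j\<rbrakk> \<Longrightarrow> i = j"
    and len_pos: "\<lbrakk>i < 4; j < 4; i \<noteq> j\<rbrakk> \<Longrightarrow> 0 < len i j"
    and len_sym: "\<lbrakk>i < 4; j < 4; i \<noteq> j\<rbrakk> \<Longrightarrow> len j i = len i j"
    and pt_sym: "\<lbrakk>i < 4; j < 4; i \<noteq> j; k \<le> len i j\<rbrakk> \<Longrightarrow> pt j i k = pt i j (len i j - k)"
    and pt_0: "\<lbrakk>i < 4; j < 4; i \<noteq> j\<rbrakk> \<Longrightarrow> pt i j 0 = b i"
    and pt_inj: "\<lbrakk>i < 4; j < 4; i \<noteq> j; k \<le> len i j; l \<le> len i j; pt i j k = pt i j l\<rbrakk> \<Longrightarrow> k = l"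
    and pt_neq_b: "\<lbrakk>i < 4; j < 4; i \<noteq> j; 0 < k; k < len i j; l < 4\<rbrakk> \<Longrightarrow> pt i j k \<noteq> b l"
    and pt_eqD: "\<lbrakk>i < 4; j < 4; i \<noteq> j; 0 < k; k < len i j; i' < 4; j' < 4; i' \<noteq> j'; l \<le> len i' j';
        pt i j k = pt i' j' l\<rbrakk> \<Longrightarrow> {i, j} = {i', j'}"
    and V_iff: "v \<in> V \<longleftrightarrow> (\<exists>i j k. i < 4 \<and> j < 4 \<and> i \<noteq> j \<and> k \<le> len i j \<and> v = pt i j k)"
    and E_iff: "E u v \<longleftrightarrow> (\<exists>i j k. i < 4 \<and> j < 4 \<and> i \<noteq> j \<and> k < len i j \<and>
        u = pt i j k \<and> v = pt i j (Suc k))"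
begin

lemma pt_len: "\<lbrakk>i < 4; j < 4; i \<noteq> j\<rbrakk> \<Longrightarrow> pt i j (len i j) = b j"
  using pt_sym[of j i 0] pt_0[of j i] len_sym[of i j] pt_sym[of i j 0] by simp

lemma pt_in_V: "\<lbrakk>i < 4; j < 4; i \<noteq> j; k \<le> len i j\<rbrakk> \<Longrightarrow> pt i j k \<in> V"
  using V_iff by blast

lemma b_in_V: "i < 4 \<Longrightarrow> b i \<in> V"
  using pt_in_V[of i "if i = 0 then 1 else 0" 0] pt_0[of i "if i = 0 then 1 else 0"]
  by (auto split: if_splits)

lemma edge: "\<lbrakk>i < 4; j < 4; i \<noteq> j; k < len i j\<rbrakk> \<Longrightarrow> E (pt i j k) (pt i j (Suc k))"
  using E_iff by blast

lemma E_sym: "E u v \<Longrightarrow> E v u"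
proof -
  assume "E u v"
  then obtain i j k where *: "i < 4" "j < 4" "i \<noteq> j" "k < len i j" "u = pt i j k" "v = pt i j (Suc k)"
    using E_iff by blast
  have "u = pt j i (len i j - k)" "v = pt j i (len i j - Suc k)"
    using * pt_sym[of j i k] pt_sym[of j i "Suc k"] len_sym[of i j] by auto
  moreover have "len i j - k = Suc (len i j - Suc k)"
    using * by simp
  ultimately show "E v u"
    using * len_sym[of i j] edge[of j i "len i j - Suc k"] by auto
qed

lemma E_in_V: "E u v \<Longrightarrow> u \<in> V \<and> v \<in> V"
  unfolding E_iff V_iff by (metis Suc_leI less_imp_le)

lemma E_irrefl: "E u v \<Longrightarrow> u \<noteq> v"
  unfolding E_iff using pt_inj by (metis Suc_leI less_imp_le n_not_Suc_n)

lemma vertex_cases: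
  assumes "v \<in> V"
  obtains (branch) i where "i < 4" "v = b i"
  | (interior) i j k where "i < 4" "j < 4" "i \<noteq> j" "0 < k" "k < len i j" "v = pt i j k"
proof -
  obtain i j k where *: "i < 4" "j < 4" "i \<noteq> j" "k \<le> len i j" "v = pt i j k"
    using assms V_iff by blast
  then consider "k = 0" | "k = len i j" | "0 < k" "k < len i j"
    by linarith
  then show ?thesis
    using * pt_0[of i j] pt_len[of i j] that by cases auto
qed

text \<open>An interior vertex lies on one path only, up to its two orientations, so every edge at
  it is a step along that path.\<close>

lemma nbr_interior:
  assumes "i < 4" "j < 4" "i \<noteq> j" "0 < k" "k < len i j" "E (pt i j k) v"
  shows "v = pt i j (k - 1) \<or> v = pt i j (Suc k)"
proof -
  obtain i' j' k' where *: "i' < 4" "j' < 4" "i' \<noteq> j'" "k' < len i' j'"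
    "pt i j k = pt i' j' k'" "v = pt i' j' (Suc k')"
    using assms E_iff by auto
  have "{i, j} = {i', j'}"
    using pt_eqD[of i j k i' j' k'] assms * by auto
  then consider "i' = i" "j' = j" | "i' = j" "j' = i"
    by (auto simp: doubleton_eq_iff)
  then show ?thesis
  proof cases
    case 1
    then show ?thesis
      using * assms pt_inj[of i j k k'] by auto
  next
    case 2
    then have "k' < len i j"
      using * len_sym[of i j] assms by simp
    then have "pt i j k = pt i j (len i j - k')" "v = pt i j (len i j - Suc k')"
      using 2 * assms pt_sym[of i j k'] pt_sym[of i j "Suc k'"] by auto
    then show ?thesis
      using assms pt_inj[of i j k "len i j - k'"] by auto
  qed
qed

text \<open>In \<open>E_iff\<close> the first vertex of an edge is never the last one of its
  oriented path, so a branch vertex can occur there only at position 0.\<close>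

lemma nbr_branch:
  assumes "i < 4" "E (b i) v"
  obtains j where "j < 4" "j \<noteq> i" "v = pt i j 1"
proof -
  obtain i' j' k' where *: "i' < 4" "j' < 4" "i' \<noteq> j'" "k' < len i' j'"
    "b i = pt i' j' k'" "v = pt i' j' (Suc k')"
    using assms E_iff by auto
  then have "k' = 0"
    using pt_neq_b[of i' j' k' i] assms by (cases "k' = 0") auto
  then show ?thesis
    using * pt_0[of i' j'] b_inj[of i i'] assms that by auto
qed

text \<open>A common first vertex would be interior to one path and lie on another, or be the common
  other end of two single edges.\<close>

lemma first_pt_inj:
  assumes "i < 4" "j < 4" "j \<noteq> i" "j' < 4" "j' \<noteq> i" "pt i j 1 = pt i j' 1"
  shows "j = j'"
proof -
  have pos: "0 < len i j" "0 < len i j'"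
    using len_pos assms by auto
  consider "1 < len i j" | "1 < len i j'" | "len i j = 1" "len i j' = 1"
    using pos by linarith
  then show ?thesis
  proof cases
    case 1
    then show ?thesis
      using pt_eqD[of i j 1 i j' 1] assms pos by (auto simp: doubleton_eq_iff)
  next
    case 2
    then show ?thesis
      using pt_eqD[of i j' 1 i j 1] assms pos by (auto simp: doubleton_eq_iff)
  next
    case 3
    then show ?thesis
      using pt_len[of i j] pt_len[of i j'] b_inj[of j j'] assms by auto
  qed
qed

lemma b_adj_b:
  assumes "i < 4" "j < 4" "E (b i) (b j)"
  shows "i \<noteq> j \<and> len i j = 1"
proof -
  obtain j' where j': "j' < 4" "j' \<noteq> i" "b j = pt i j' 1"
    using nbr_branch assms by blast
  then have "len i j' = 1"
    using pt_neq_b[of i j' 1 j] len_pos[of i j'] assms by fastforce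
  then show ?thesis
    using j' pt_len[of i j'] b_inj[of j j'] assms by auto
qed

lemma same_path_adj:
  assumes "i < 4" "j < 4" "i \<noteq> j" "1 < len i j" "k \<le> len i j" "l \<le> len i j" "E (pt i j k) (pt i j l)"
  shows "l = Suc k \<or> k = Suc l"
proof -
  have step: "l = Suc k \<or> k = Suc l"
    if "0 < k" "k < len i j" "l \<le> len i j" "E (pt i j k) (pt i j l)" for k l
    using nbr_interior[of i j k "pt i j l"] that assms(1-3) pt_inj[of i j l "k - 1"] pt_inj[of i j l "Suc k"]
    by fastforce
  consider "0 < k" "k < len i j" | "0 < l" "l < len i j" | "k \<in> {0, len i j}" "l \<in> {0, len i j}"
    using assms by fastforce
  then show ?thesis
  proof cases
    case 1
    then show ?thesis
      using step assms by blast
  next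
    case 2
    then show ?thesis
      using step[of l k] assms E_sym by blast
  next
    case 3
    then show ?thesis
      using b_adj_b[of i j] b_adj_b[of j i] assms len_sym[of i j] pt_0[of i j] pt_len[of i j] E_irrefl
      by auto
  qed
qed

lemma finite_V: "finite V"
proof -
  have "V \<subseteq> (\<Union>i\<in>{..<4}. \<Union>j\<in>{..<4}. pt i j ` {..len i j})"
  proof
    fix v
    assume "v \<in> V"
    then obtain i j k where "i < 4" "j < 4" "k \<le> len i j" "v = pt i j k"
      using V_iff by blast
    then show "v \<in> (\<Union>i\<in>{..<4}. \<Union>j\<in>{..<4}. pt i j ` {..len i j})"
      by blast
  qed
  then show ?thesis
    by (rule finite_subset) auto
qed

lemma degree_le_3: "card {v. E y v} \<le> 3" and finite_nbrs: "finite {v. E y v}"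
proof -
  have "\<exists>A. finite A \<and> card A \<le> 3 \<and> {v. E y v} \<subseteq> A"
  proof (cases "y \<in> V")
    case True
    then show ?thesis
    proof (cases rule: vertex_cases)
      case (branch i)
      have "card ((\<lambda>j. pt i j 1) ` ({..<4} - {i})) \<le> card ({..<4::nat} - {i})"
        by (rule card_image_le) simp
      moreover have "{v. E y v} \<subseteq> (\<lambda>j. pt i j 1) ` ({..<4} - {i})"
        using branch nbr_branch by blast
      ultimately show ?thesis
        using branch by (intro exI[of _ "(\<lambda>j. pt i j 1) ` ({..<4} - {i})"]) auto
    next
      case (interior i j k)
      then have "{v. E y v} \<subseteq> {pt i j (k - 1), pt i j (Suc k)}"
        using nbr_interior by blast
      moreover have "card {pt i j (k - 1), pt i j (Suc k)} \<le> 3"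
        using card_insert_le_m1[of 3 "{pt i j (Suc k)}" "pt i j (k - 1)"] by simp
      ultimately show ?thesis
        by (intro exI[of _ "{pt i j (k - 1), pt i j (Suc k)}"]) auto
    qed
  next
    case False
    then show ?thesis
      using E_in_V by (intro exI[of _ "{}"]) auto
  qed
  then obtain A where A: "finite A" "card A \<le> 3" "{v. E y v} \<subseteq> A"
    by blast
  show "card {v. E y v} \<le> 3"
    using card_mono[OF A(1,3)] A(2) by simp
  show "finite {v. E y v}"
    using finite_subset[OF A(3,1)] .
qed

text \<open>Counts the four branch vertices and, for every subdivided edge, the first interior
  vertex of its path.\<close>

lemma card_V_ge: "4 + card {(i, j). i < j \<and> j < 4 \<and> 1 < len i j} \<le> card V"
proof -
  define S where "S = {(i, j). i < j \<and> j < 4 \<and> 1 < len i j}"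
  have "S \<subseteq> {..<4} \<times> {..<4}"
    by (auto simp: S_def)
  then have fin: "finite S"
    by (rule finite_subset) auto
  have "inj_on (\<lambda>(i, j). pt i j 1) S"
  proof (rule inj_onI; clarify)
    fix i j i' j'
    assume *: "(i, j) \<in> S" "(i', j') \<in> S" "pt i j 1 = pt i' j' 1"
    then have "{i, j} = {i', j'}"
      using pt_eqD[of i j 1 i' j' 1] by (simp add: S_def)
    then show "i = i' \<and> j = j'"
      using * by (auto simp: S_def doubleton_eq_iff)
  qed
  then have "card ((\<lambda>(i, j). pt i j 1) ` S) = card S"
    by (rule card_image)
  moreover have "card (b ` {..<4}) = 4"
    using b_inj by (subst card_image) (auto simp: inj_on_def)
  moreover have "b ` {..<4} \<inter> (\<lambda>(i, j). pt i j 1) ` S = {}"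
    using pt_neq_b[of _ _ 1] by (auto simp: S_def dest!: sym[of "b _"])
  ultimately have "card (b ` {..<4} \<union> (\<lambda>(i, j). pt i j 1) ` S) = 4 + card S"
    using fin by (subst card_Un_disjoint) auto
  moreover have "b ` {..<4} \<union> (\<lambda>(i, j). pt i j 1) ` S \<subseteq> V"
    using b_in_V pt_in_V by (auto simp: S_def)
  ultimately show ?thesis
    unfolding S_def[symmetric] using card_mono[OF finite_V] by metis
qed

text \<open>The three paths among the branch vertices other than \<open>b l\<close> form a cycle.
  Here \<open>b l\<close> is \<open>s\<close> itself or an end of the path that has \<open>s\<close>
  in its interior. Only the two neighbours within \<open>T\<close> matter later, so the cyclic order
  is not recorded.\<close>

lemma cycle_avoiding:
  assumes "s \<in> V"
  shows "\<exists>T\<subseteq>V. T \<noteq> {} \<and> s \<notin> T \<and> (\<forall>u\<in>T. \<exists>v\<in>T. \<exists>w\<in>T. v \<noteq> w \<and> E u v \<and> E u w)"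
proof -
  obtain l where l: "l < 4" "\<And>i j k. \<lbrakk>i < 4; j < 4; i \<noteq> j; i \<noteq> l; j \<noteq> l; k \<le> len i j\<rbrakk> \<Longrightarrow> pt i j k \<noteq> s"
    using assms
  proof (cases rule: vertex_cases)
    case (branch l)
    have "pt i j k \<noteq> s" if ij: "i < 4" "j < 4" "i \<noteq> j" "i \<noteq> l" "j \<noteq> l" "k \<le> len i j" for i j k
    proof -
      consider "k = 0" | "k = len i j" | "0 < k" "k < len i j"
        using ij by linarith
      then show ?thesis
        using ij branch pt_0[of i j] pt_len[of i j] pt_neq_b[of i j k l] b_inj[of i l] b_inj[of j l]
        by cases auto
    qed
    then show ?thesis
      using branch that by blast
  next
    case (interior i j k)
    have "pt i' j' k' \<noteq> s" if "i' < 4" "j' < 4" "i' \<noteq> j'" "i' \<noteq> i" "j' \<noteq> i" "k' \<le> len i' j'" for i' j' k'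
      using pt_eqD[of i j k i' j' k'] interior that by (auto simp: doubleton_eq_iff)
    then show ?thesis
      using interior that by blast
  qed
  define T where "T = {pt i j k | i j k. i < 4 \<and> j < 4 \<and> i \<noteq> j \<and> i \<noteq> l \<and> j \<noteq> l \<and> k \<le> len i j}"
  have T: "pt i j k \<in> T" if "i < 4" "j < 4" "i \<noteq> j" "i \<noteq> l" "j \<noteq> l" "k \<le> len i j" for i j k
    using that unfolding T_def by blast
  have two: "\<exists>j k. j < 4 \<and> k < 4 \<and> j \<noteq> k \<and> j \<noteq> l \<and> k \<noteq> l \<and> j \<noteq> i \<and> k \<noteq> i" for i :: nat
  proof -
    have "2 \<le> card ({..<4} - {i, l})"
      using card_Diff_subset[of "{i, l}" "{..<4}"] diff_card_le_card_Diff[of "{i, l}" "{..<4::nat}"]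
        card_insert_le_m1[of 2 "{l}" i] by simp
    then obtain A where A: "A \<subseteq> {..<4} - {i, l}" "card A = 2"
      using obtain_subset_with_card_n by metis
    then obtain j k where "A = {j, k}" "j \<noteq> k"
      using card_2_iff[of A] by blast
    then show ?thesis
      using A(1) by blast
  qed
  have branch2: "\<exists>v\<in>T. \<exists>w\<in>T. v \<noteq> w \<and> E (b i) v \<and> E (b i) w" if "i < 4" "i \<noteq> l" for i
  proof -
    obtain j k where jk: "j < 4" "k < 4" "j \<noteq> k" "j \<noteq> l" "k \<noteq> l" "j \<noteq> i" "k \<noteq> i"
      using two by blast
    then have "pt i j 1 \<in> T" "pt i k 1 \<in> T" "pt i j 1 \<noteq> pt i k 1"
      using that T[of i j 1] T[of i k 1] len_pos[of i j] len_pos[of i k] first_pt_inj[of i j k] by auto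
    moreover have "E (b i) (pt i j 1)" "E (b i) (pt i k 1)"
      using edge[of i j 0] edge[of i k 0] pt_0[of i j] pt_0[of i k] len_pos[of i j] len_pos[of i k] that jk
      by auto
    ultimately show ?thesis
      by blast
  qed
  show ?thesis
  proof (intro exI[of _ T] conjI ballI)
    show "T \<subseteq> V"
      using pt_in_V by (auto simp: T_def)
    show "T \<noteq> {}"
      using T two[of l] by blast
    show "s \<notin> T"
      using l by (auto simp: T_def)
    show "\<exists>v\<in>T. \<exists>w\<in>T. v \<noteq> w \<and> E u v \<and> E u w" if uT: "u \<in> T" for u
    proof -
      obtain i j k where *: "i < 4" "j < 4" "i \<noteq> j" "i \<noteq> l" "j \<noteq> l" "k \<le> len i j" "u = pt i j k"
        using uT unfolding T_def by blast
      then consider "u = b i" | "u = b j" | "0 < k" "k < len i j"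
        using pt_0[of i j] pt_len[of i j] le_neq_implies_less by blast
      then show ?thesis
      proof cases
        case 3
        have "pt i j (k - 1) \<noteq> pt i j (Suc k)"
        proof
          assume "pt i j (k - 1) = pt i j (Suc k)"
          then have "k - 1 = Suc k"
            using 3 by (intro pt_inj[OF *(1-3)]) auto
          then show False
            by simp
        qed
        moreover have "E u (pt i j (k - 1))" "E u (pt i j (Suc k))"
          using edge[of i j "k - 1"] edge[of i j k] E_sym * 3 by auto
        ultimately show ?thesis
          using T[of i j "k - 1"] T[of i j "Suc k"] * 3 by auto
      qed (use branch2 * in auto)
    qed
  qed
qed

section \<open>Connectivity outside a closed neighbourhood, and the obstruction\<close>

definition unsubdivided_matching :: bool where
  "unsubdivided_matching \<longleftrightarrow>
    (\<forall>i<4. \<forall>j<4. \<forall>k<4. i \<noteq> j \<longrightarrow> i \<noteq> k \<longrightarrow> len i j = 1 \<longrightarrow> len i k = 1 \<longrightarrow> j = k)"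

text \<open>Connectivity is phrased as invariance: a property \<open>Q\<close> preserved by steps
  outside the closed neighbourhood of \<open>y\<close> spreads to every vertex there. Each vertex is
  first moved along its path to a surviving branch vertex; then the surviving branch vertices are
  joined.\<close>

lemma nonneighbours_connected:
  assumes matching: unsubdivided_matching and y: "y \<in> V"
    and step: "\<And>u v. \<lbrakk>E u v; u \<noteq> y; v \<noteq> y; \<not> E y u; \<not> E y v; Q u\<rbrakk> \<Longrightarrow> Q v"
    and u: "u \<in> V" "u \<noteq> y" "\<not> E y u" "Q u"
    and v: "v \<in> V" "v \<noteq> y" "\<not> E y v"
  shows "Q v"
proof -
  define far where "far u \<longleftrightarrow> u \<noteq> y \<and> \<not> E y u" for u
  have segment: "Q (pt i j k) \<longleftrightarrow> Q (pt i j l)"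
    if "i < 4" "j < 4" "i \<noteq> j" "k \<le> l" "l \<le> len i j" "\<And>m. k \<le> m \<Longrightarrow> m \<le> l \<Longrightarrow> far (pt i j m)" for i j k l
    using that(4-)
  proof (induction l rule: dec_induct)
    case (step l)
    have "E (pt i j l) (pt i j (Suc l))" "far (pt i j l)" "far (pt i j (Suc l))"
      using edge[of i j l] step that(1-3) by auto
    then have "Q (pt i j l) \<longleftrightarrow> Q (pt i j (Suc l))"
      using assms(3) E_sym unfolding far_def by blast
    then show ?case
      using step by auto
  qed simp
  have to_branch: "\<exists>i<4. far (b i) \<and> (Q x \<longleftrightarrow> Q (b i))" if x: "x \<in> V" "far x" for x
    using x(1)
  proof (cases rule: vertex_cases)
    case (interior i j k)
    \<comment> \<open>The deletion cannot cut the path on both sides of a surviving interior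
      vertex.\<close>
    have "(\<forall>m\<le>k. far (pt i j m)) \<or> (\<forall>m\<le>len i j. k \<le> m \<longrightarrow> far (pt i j m))"
    proof (rule ccontr)
      assume "\<not> ?thesis"
      then obtain m n where mn: "m \<le> k" "\<not> far (pt i j m)" "k \<le> n" "n \<le> len i j" "\<not> far (pt i j n)"
        by blast
      then have "m < k" "k < n"
        using x interior by (auto simp: le_less)
      show False
      proof (cases "\<exists>l\<le>len i j. y = pt i j l")
        case True
        then obtain l where l: "l \<le> len i j" "y = pt i j l"
          by blast
        have "p = l \<or> p = Suc l \<or> l = Suc p" if "p \<le> len i j" "\<not> far (pt i j p)" for p
          using that same_path_adj[of i j l p] l interior pt_inj[of i j p l] unfolding far_def by fastforce
        \<comment> \<open>Deleted positions are within distance 1 of \<open>l\<close>, so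
          \<open>m < k < n\<close> forces \<open>m = l - 1\<close> and \<open>n = l + 1\<close>; the
          surviving vertex would be \<open>y\<close>.\<close>
        from this[of m] this[of n] have "k = l"
          using mn \<open>m < k\<close> \<open>k < n\<close> interior by auto
        then show False
          using x l interior far_def by auto
      next
        case False
        \<comment> \<open>Neighbours of an interior vertex stay on the path, so a vertex
          \<open>y\<close> off the path can delete only its ends.\<close>
        have ends: "p = 0 \<or> p = len i j" if "p \<le> len i j" "\<not> far (pt i j p)" for p
        proof (rule ccontr)
          assume "\<not> ?thesis"
          then have p: "0 < p" "p < len i j"
            using that by auto
          have "E (pt i j p) y"
            using that False E_sym unfolding far_def by blast
          then have "y = pt i j (p - 1) \<or> y = pt i j (Suc p)"
            using p nbr_interior interior by blast
          moreover have "p - 1 \<le> len i j" "Suc p \<le> len i j"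
            using p by auto
          ultimately show False
            using False by blast
        qed
        have "m = 0" "n = len i j"
          using ends[of m] ends[of n] mn \<open>m < k\<close> \<open>k < n\<close> interior by auto
        then have "E (b i) y" "E (b j) y"
          using mn False E_sym interior pt_0[of i j] pt_len[of i j] unfolding far_def by auto
        then obtain i' j' where i': "i' < 4" "i' \<noteq> i" "y = pt i i' 1" and j': "j' < 4" "j' \<noteq> j" "y = pt j j' 1"
          using nbr_branch interior by metis
        have "1 \<le> len i j"
          using interior by simp
        then have "pt i j 1 \<noteq> y" "pt j i 1 \<noteq> y"
          using False pt_sym[of i j 1] interior diff_le_self by metis+
        then have "i' \<noteq> j" "j' \<noteq> i"
          using i' j' by auto
        \<comment> \<open>Otherwise \<open>y\<close> would be interior to one of two different paths
          and lie on the other. Hence \<open>y\<close> is a branch vertex with unsubdivided edges to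
          both \<open>b i\<close> and \<open>b j\<close>, against the matching hypothesis.\<close>
        then have "len i i' = 1" "len j j' = 1"
          using pt_eqD[of i i' 1 j j' 1] pt_eqD[of j j' 1 i i' 1] len_pos[of i i'] len_pos[of j j'] i' j' interior
          by (fastforce simp: doubleton_eq_iff)+
        then have "i' = j'" "len i' i = 1" "len i' j = 1"
          using i' j' interior pt_len[of i i'] pt_len[of j j'] b_inj[of i' j'] len_sym[of i i'] len_sym[of j j']
          by auto
        then show False
          using matching i' j' interior unfolding unsubdivided_matching_def by metis
      qed
    qed
    then show ?thesis
    proof
      assume *: "\<forall>m\<le>k. far (pt i j m)"
      then show ?thesis
        using segment[of i j 0 k] interior pt_0[of i j] by (intro exI[of _ i]) auto
    next
      assume *: "\<forall>m\<le>len i j. k \<le> m \<longrightarrow> far (pt i j m)"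
      then show ?thesis
        using segment[of i j k "len i j"] interior pt_len[of i j] by (intro exI[of _ j]) auto
    qed
  qed (use x in auto)
  \<comment> \<open>The ends survive, so a deleted vertex is interior; it equals \<open>y\<close> or
    is adjacent to \<open>y\<close>, and either way \<open>y\<close> is on this path.\<close>
  have blocked: "\<exists>k. 0 < k \<and> k < len i j \<and> y = pt i j k"
    if ij: "i < 4" "j < 4" "i \<noteq> j" "far (b i)" "far (b j)" and p: "p \<le> len i j" "\<not> far (pt i j p)" for i j p
  proof -
    have p': "0 < p" "p < len i j"
      using ij p pt_0[of i j] pt_len[of i j] by (metis gr0I, metis le_neq_implies_less)
    have "y = pt i j p \<or> y = pt i j (p - 1) \<or> y = pt i j (Suc p)"
      using p p' ij nbr_interior[of i j p y] E_sym unfolding far_def by blast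
    then obtain k where k: "k \<le> len i j" "y = pt i j k"
      using p' by (metis Suc_leI diff_le_self le_trans p(1))
    then have "k \<noteq> 0" "k \<noteq> len i j"
      using ij pt_0[of i j] pt_len[of i j] unfolding far_def by metis+
    then show ?thesis
      using k by auto
  qed
  have branches: "Q (b i) \<longleftrightarrow> Q (b j)" if ij: "i < 4" "j < 4" "far (b i)" "far (b j)" for i j
  proof (cases "i = j")
    case False
    have direct: "Q (b i) \<longleftrightarrow> Q (b j)"
      if "i < 4" "j < 4" "i \<noteq> j" "\<forall>m\<le>len i j. far (pt i j m)" for i j
      using segment[of i j 0 "len i j"] that pt_0[of i j] pt_len[of i j] by auto
    show ?thesis
    proof (cases "\<forall>m\<le>len i j. far (pt i j m)")
      case True
      then show ?thesis
        using direct ij False by blast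
    next
      case blk: False
      then obtain k where k: "0 < k" "k < len i j" "y = pt i j k"
        using blocked ij False by blast
      \<comment> \<open>With \<open>y\<close> inside the direct path, the detour through a third
        branch vertex is free: the neighbours of \<open>y\<close> lie on the direct path, which
        misses \<open>b l\<close>.\<close>
      obtain l where l: "l < 4" "l \<noteq> i" "l \<noteq> j"
        using that[of 0] that[of 1] that[of 2] by fastforce
      have "far (b l)"
      proof (rule ccontr)
        assume "\<not> far (b l)"
        moreover have "b l \<noteq> pt i j p" if "p \<le> len i j" for p
          using that l ij False pt_neq_b[of i j p l] pt_0[of i j] pt_len[of i j] b_inj[of l]
          by (metis le_neq_implies_less not_gr_zero)
        ultimately show False
          using k nbr_interior[of i j k "b l"] ij False unfolding far_def
          by (metis Suc_leI diff_le_self le_trans less_imp_le)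
      qed
      have clear: "\<forall>m\<le>len i' l. far (pt i' l m)" if i': "i' = i \<or> i' = j" for i'
      proof (rule ccontr)
        assume "\<not> ?thesis"
        then obtain k' where "0 < k'" "k' < len i' l" "y = pt i' l k'"
          using blocked[of i' l] i' ij l \<open>far (b l)\<close> by blast
        then show False
          using pt_eqD[of i j k i' l k'] k i' ij l False by (auto simp: doubleton_eq_iff)
      qed
      show ?thesis
        using direct[of i l] direct[of j l] clear ij l by blast
    qed
  qed simp
  obtain i j where "i < 4" "far (b i)" "Q u \<longleftrightarrow> Q (b i)" "j < 4" "far (b j)" "Q v \<longleftrightarrow> Q (b j)"
    using to_branch[of u] to_branch[of v] u v unfolding far_def by blast
  then show ?thesis
    using branches u by blast
qed

text \<open>Degrees are at most 3, so the two neighbourhoods cover at most six vertices, among them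
  \<open>x\<close> and \<open>y\<close>, while there are at least eight vertices.\<close>

lemma common_nonneighbour:
  assumes "4 \<le> card {(i, j). i < j \<and> j < 4 \<and> 1 < len i j}" "E x y"
  obtains w where "w \<in> V" "w \<noteq> x" "w \<noteq> y" "\<not> E x w" "\<not> E y w"
proof -
  have "card ({v. E x v} \<union> {v. E y v}) \<le> 6"
    using card_Un_le[of "{v. E x v}" "{v. E y v}"] degree_le_3[of x] degree_le_3[of y] by linarith
  then have "\<not> V \<subseteq> {v. E x v} \<union> {v. E y v}"
    using card_mono[of "{v. E x v} \<union> {v. E y v}" V] finite_nbrs card_V_ge assms by fastforce
  then show ?thesis
    using that assms(2) E_sym by blast
qed

lemma matching_not_restricted_frame_graph:
  assumes triangle_free: "triangle_free V E" and matching: unsubdivided_matching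
    and subdivided: "4 \<le> card {(i, j). i < j \<and> j < 4 \<and> 1 < len i j}"
  shows "\<not> restricted_frame_graph V E"
proof
  assume "restricted_frame_graph V E"
  then show False
  proof (rule restricted_frame_graphD)
    fix F :: "'a \<Rightarrow> frame"
    assume ok: "\<And>v. v \<in> V \<Longrightarrow> frame_ok (F v)"
      and adj: "\<And>u v. \<lbrakk>u \<in> V; v \<in> V; u \<noteq> v; E u v\<rbrakk> \<Longrightarrow> pokes (F u) (F v) \<or> pokes (F v) (F u)"
      and nonadj: "\<And>u v. \<lbrakk>u \<in> V; v \<in> V; u \<noteq> v; \<not> E u v\<rbrakk> \<Longrightarrow>
        inside (F u) (F v) \<or> inside (F v) (F u) \<or> apart (F u) (F v)"
      and four: "\<And>u v w. \<lbrakk>u \<in> V; v \<in> V; w \<in> V; u \<noteq> v; E u v\<rbrakk> \<Longrightarrow>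
        \<not> (inside (F w) (F u) \<and> inside (F w) (F v))"
    have all_inside: "inside (F v) (F y)"
      if "y \<in> V" "u \<in> V" "inside (F u) (F y)" "v \<in> V" "v \<noteq> y" "\<not> E y v" for y u v
    proof (rule nonneighbours_connected[where Q = "\<lambda>v. inside (F v) (F y)", OF matching])
      show "u \<noteq> y"
        using that by (auto simp: inside_def)
      then show "\<not> E y u"
        using adj[of y u] that unfolding pokes_def inside_def by fastforce
      \<comment> \<open>The frames of \<open>u'\<close> and \<open>v'\<close> overlap, so
        \<open>v'\<close> is not apart from \<open>y\<close>. If \<open>v'\<close> surrounded
        \<open>y\<close>, it would also surround \<open>u'\<close>, which excludes poking.\<close>
      show "inside (F v') (F y)"
        if "E u' v'" "u' \<noteq> y" "v' \<noteq> y" "\<not> E y u'" "\<not> E y v'" "inside (F u') (F y)" for u' v'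
        using adj[of u' v'] nonadj[of y v'] E_in_V[OF that(1)] E_irrefl[OF that(1)] that \<open>y \<in> V\<close>
          ok[of u'] ok[of v'] ok[of y]
        unfolding pokes_def inside_def apart_def frame_ok_def by argo
    qed (use that in auto)
    have unique: "y = z"
      if "y \<in> V" "z \<in> V" "u \<in> V" "inside (F u) (F y)" "v \<in> V" "inside (F v) (F z)" for y z u v
    proof (rule ccontr)
      assume "y \<noteq> z"
      show False
      proof (cases "E y z")
        case True
        then obtain w where "w \<in> V" "w \<noteq> y" "w \<noteq> z" "\<not> E y w" "\<not> E z w"
          using common_nonneighbour subdivided by blast
        then have "inside (F w) (F y)" "inside (F w) (F z)"
          using all_inside that by blast+
        then show False
          using four that True \<open>w \<in> V\<close> \<open>y \<noteq> z\<close> by blast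
      next
        case False
        then have "inside (F z) (F y)" "inside (F y) (F z)"
          using all_inside that \<open>y \<noteq> z\<close> E_sym by blast+
        then show False
          by (simp add: inside_def)
      qed
    qed
    \<comment> \<open>If no frame contains another, \<open>b 0\<close> serves as a default for
      \<open>s\<close>.\<close>
    obtain s where s: "s \<in> V" "\<And>y u. \<lbrakk>y \<in> V; u \<in> V; inside (F u) (F y)\<rbrakk> \<Longrightarrow> y = s"
      using unique b_in_V[of 0] by (metis zero_less_numeral)
    obtain T where T: "T \<subseteq> V" "T \<noteq> {}" "s \<notin> T"
      "\<And>u. u \<in> T \<Longrightarrow> \<exists>v\<in>T. \<exists>w\<in>T. v \<noteq> w \<and> E u v \<and> E u w"
      using cycle_avoiding[OF s(1)] by blast
    have "finite T"
      using T finite_V finite_subset by blast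
    then obtain u where u: "u \<in> T" "\<And>v. v \<in> T \<Longrightarrow> yt (F u) - yb (F u) \<le> yt (F v) - yb (F v)"
      using arg_min_least[OF _ T(2), where f = "\<lambda>v. yt (F v) - yb (F v)"]
        arg_min_if_finite(1)[OF _ T(2), where f = "\<lambda>v. yt (F v) - yb (F v)"] by blast
    obtain v w where vw: "v \<in> T" "w \<in> T" "v \<noteq> w" "E u v" "E u w"
      using T(4) u by blast
    have "pokes (F u) (F x)" if "x \<in> T" "E u x" for x
    proof -
      have "pokes (F u) (F x) \<or> pokes (F x) (F u)"
        using adj[of u x] u(1) that T(1) E_irrefl by blast
      then show ?thesis
        using u(2)[OF that(1)] unfolding pokes_def by linarith
    qed
    then have "pokes (F u) (F v)" "pokes (F u) (F w)"
      using vw by auto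
    moreover have "\<not> E v w"
      using triangle_free vw u(1) T(1) unfolding triangle_free_def by blast
    moreover have "v \<in> V" "w \<in> V" "frame_ok (F u)"
      using vw u T(1) ok by auto
    \<comment> \<open>The left side of \<open>u\<close> lies in both regions, so \<open>v\<close>
      and \<open>w\<close> cannot be apart.\<close>
    ultimately have "inside (F v) (F w) \<or> inside (F w) (F v)"
      using nonadj[of v w] vw(3) unfolding pokes_def apart_def frame_ok_def by linarith
    then show False
      using s(2) vw T(1,3) by blast
  qed
qed

end

text \<open>Integer coordinates turn the comparison of frames into linear integer arithmetic in the
  positions on the paths.\<close>

definition int_frame :: "int \<Rightarrow> int \<Rightarrow> int \<Rightarrow> int \<Rightarrow> frame" where
  "int_frame l r bo t = \<lparr>xl = of_int l, xr = of_int r, yb = of_int bo, yt = of_int t\<rparr>"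

lemma int_frame_simps:
  "frame_ok (int_frame l r bo t) \<longleftrightarrow> l < r \<and> bo < t"
  "pokes (int_frame l r bo t) (int_frame l' r' bo' t') \<longleftrightarrow>
     l' < l \<and> l < r' \<and> r' < r \<and> bo' < bo \<and> t < t'"
  "inside (int_frame l r bo t) (int_frame l' r' bo' t') \<longleftrightarrow> l' < l \<and> r < r' \<and> bo' < bo \<and> t < t'"
  "apart (int_frame l r bo t) (int_frame l' r' bo' t') \<longleftrightarrow> r < l' \<or> r' < l \<or> t < bo' \<or> t' < bo"
  "xr (int_frame l r bo t) = of_int r"
  by (auto simp: int_frame_def frame_ok_def pokes_def inside_def apart_def)

section \<open>The frames of the construction\<close>

text \<open>
  \<open>p\<close>, \<open>q\<close>, \<open>n\<close>, \<open>m\<close> are the lengths of the paths from \<open>e\<close> to \<open>c\<close>, from \<open>e\<close> to \<open>d\<close>, from \<open>e\<close> to \<open>a\<close>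
  and from \<open>d\<close> to \<open>c\<close>. \<open>Hub\<close> is \<open>a\<close>; the other constructors give the \<open>k\<close>-th vertex of these paths,
  counted from 0, where \<open>valid\<close> selects one name for each vertex: \<open>e\<close> is \<open>Apos 0\<close>, \<open>c\<close> is \<open>Cpos p\<close>
  and \<open>d\<close> is \<open>Dpos q\<close>.
\<close>

datatype pos = Hub | Cpos nat | Dpos nat | Apos nat | Upos nat

definition valid :: "nat \<Rightarrow> nat \<Rightarrow> nat \<Rightarrow> nat \<Rightarrow> pos \<Rightarrow> bool" where
  "valid p q n m x \<longleftrightarrow> (case x of Hub \<Rightarrow> True | Cpos k \<Rightarrow> 0 < k \<and> k \<le> p | Dpos k \<Rightarrow> 0 < k \<and> k \<le> q
     | Apos k \<Rightarrow> k < n | Upos k \<Rightarrow> 0 < k \<and> k < m)"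

text \<open>Each edge is listed in one orientation only, so adjacency of names is
  \<open>link\<close> in either order.\<close>

fun link :: "nat \<Rightarrow> nat \<Rightarrow> nat \<Rightarrow> nat \<Rightarrow> pos \<Rightarrow> pos \<Rightarrow> bool" where
  "link p q n m Hub (Cpos k) \<longleftrightarrow> k = p"
| "link p q n m Hub (Dpos k) \<longleftrightarrow> k = q"
| "link p q n m (Apos k) Hub \<longleftrightarrow> Suc k = n"
| "link p q n m (Apos k) (Apos l) \<longleftrightarrow> l = Suc k"
| "link p q n m (Apos k) (Cpos l) \<longleftrightarrow> k = 0 \<and> l = 1"
| "link p q n m (Apos k) (Dpos l) \<longleftrightarrow> k = 0 \<and> l = 1"
| "link p q n m (Cpos k) (Cpos l) \<longleftrightarrow> l = Suc k"
| "link p q n m (Dpos k) (Dpos l) \<longleftrightarrow> l = Suc k"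
| "link p q n m (Upos k) (Upos l) \<longleftrightarrow> l = Suc k"
| "link p q n m (Dpos k) (Upos l) \<longleftrightarrow> k = q \<and> l = 1"
| "link p q n m (Upos k) (Cpos l) \<longleftrightarrow> Suc k = m \<and> l = p"
| "link p q n m _ _ \<longleftrightarrow> False"

text \<open>
  \<open>hh\<close> is the height scale. The right sides of \<open>a\<close> and of the surrounding frame \<open>Upos (m - 1)\<close> are at
  \<open>aa\<close> and \<open>2 * aa\<close>.
\<close>

fun frame_at :: "nat \<Rightarrow> nat \<Rightarrow> nat \<Rightarrow> nat \<Rightarrow> int \<Rightarrow> int \<Rightarrow> pos \<Rightarrow> frame" where
  "frame_at p q n m hh aa Hub = (if n = 1 then int_frame 1 aa (1 - 5 * hh) (5 * hh - 1)
     else int_frame (- 1) aa (- 5 * hh - 1) (5 * hh + 1))"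
| "frame_at p q n m hh aa (Cpos k) = int_frame (2 * int k) (if k = p then 2 * aa + 1 else 2 * int k + 3)
     (2 * hh + int k) (4 * hh - int k)"
| "frame_at p q n m hh aa (Dpos k) = int_frame (2 * int k)
     (if k = q then (if m = 2 then 2 * aa + 1 else aa + 2) else 2 * int k + 3)
     (- 4 * hh + int k) (- 2 * hh - int k)"
| "frame_at p q n m hh aa (Apos k) = (if k = 0 then int_frame 0 3 (- 5 * hh) (5 * hh)
     else int_frame (2 * int k) (if Suc k = n then aa + 1 else 2 * int k + 3) (int k - hh) (hh - int k))"
| "frame_at p q n m hh aa (Upos k) = (if Suc k = m then int_frame (- 2) (2 * aa) (- 5 * hh - 2) (5 * hh + 2)
     else int_frame (aa - 1 + 2 * int k) (if k + 2 = m then 2 * aa + 1 else aa + 2 + 2 * int k)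
     (- 4 * hh + int q + int k) (- 2 * hh - int q - int k))"

text \<open>The chains to \<open>c\<close>, \<open>d\<close> and \<open>a\<close> use disjoint
  horizontal bands around \<open>3 * hh\<close>, \<open>- 3 * hh\<close> and 0; the chain from
  \<open>d\<close> to \<open>c\<close> continues the second one. A shift of 2 against a width of 3
  makes only consecutive frames overlap. Frames lose height 2 per step, which the bound on
  \<open>hh\<close> allows, and the bound on \<open>aa\<close> leaves room for the chains. The last
  two facts in \<open>lengths\<close> come from triangle-freeness.\<close>

locale frame_layout =
  fixes p q n m :: nat and hh aa :: int
  assumes lengths: "0 < p" "0 < q" "0 < n" "2 \<le> m" "n = 1 \<Longrightarrow> 2 \<le> p \<and> 2 \<le> q"
    and scale: "int p + int q + int n + int m + 5 \<le> hh" "2 * hh + 10 \<le> aa"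
begin

abbreviation "valid' \<equiv> valid p q n m"
abbreviation "link' \<equiv> link p q n m"
abbreviation "frame' \<equiv> frame_at p q n m hh aa"

lemma frame_at_ok: "valid' x \<Longrightarrow> frame_ok (frame' x)"
  using lengths scale by (cases x) (auto simp: valid_def int_frame_simps)

lemma link_imp_pokes:
  assumes "valid' x" "valid' y" "link' x y"
  shows "pokes (frame' x) (frame' y) \<or> pokes (frame' y) (frame' x)"
  using assms lengths scale
  by (cases x; cases y) (auto simp: valid_def int_frame_simps)

lemma not_link_imp_apart_or_nested:
  assumes "valid' x" "valid' y" "x \<noteq> y" "\<not> link' x y" "\<not> link' y x"
  shows "inside (frame' x) (frame' y) \<or> inside (frame' y) (frame' x) \<or>
    apart (frame' x) (frame' y)"
  using assms lengths scale
  by (cases x; cases y) (auto simp: valid_def int_frame_simps)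

lemma inside_imp_container:
  assumes "valid' x" "valid' y" "inside (frame' x) (frame' y)"
  shows "y = Hub \<or> y = Upos (m - 1)"
  using assms lengths scale
  by (cases x; cases y) (auto simp: valid_def int_frame_simps split: if_splits)

text \<open>This is condition (4). The surrounding frame has the leftmost left side and pokes
  nothing, so the container is \<open>Hub\<close>. It pokes only \<open>e\<close>, and every other
  frame ends to the right of 3, where \<open>e\<close> ends.\<close>

lemma inside_poking_frame:
  assumes "valid' x" "valid' y" "valid' z" "z \<noteq> x" "pokes (frame' y) (frame' x)"
    "inside (frame' z) (frame' y)"
  shows "xr (frame' x) < xr (frame' z)"
proof -
  have "y = Hub \<or> y = Upos (m - 1)"
    using inside_imp_container assms by blast
  moreover have "\<not> pokes (frame' (Upos (m - 1))) (frame' x)"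
    using assms(1) lengths scale by (cases x) (auto simp: valid_def int_frame_simps)
  ultimately have "y = Hub"
    using assms by blast
  with assms(1,5) have x: "x = Apos 0"
    using lengths scale by (cases x) (auto simp: valid_def int_frame_simps split: if_splits)
  then show ?thesis
    using assms(3,4) lengths scale by (cases z) (auto simp: valid_def int_frame_simps)
qed

end

section \<open>Two unsubdivided edges with a common end\<close>

context k4_paths
begin

text \<open>A point common to two different paths is interior to neither, hence an end of both, and
  \<open>b\<close> is injective.\<close>

lemma pt_eq_distinct_paths:
  assumes ij: "i < 4" "j < 4" "i \<noteq> j" "k \<le> len i j"
    and ij': "i' < 4" "j' < 4" "i' \<noteq> j'" "l \<le> len i' j'"
    and eq: "pt i j k = pt i' j' l" and ne: "{i, j} \<noteq> {i', j'}"
  shows "k = 0 \<and> (l = 0 \<and> i = i' \<or> l = len i' j' \<and> i = j') \<or>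
    k = len i j \<and> (l = 0 \<and> j = i' \<or> l = len i' j' \<and> j = j')"
proof -
  have "\<not> (0 < k \<and> k < len i j)"
    using pt_eqD[of i j k i' j' l] assms by auto
  moreover have "\<not> (0 < l \<and> l < len i' j')"
    using pt_eqD[of i' j' l i j k] assms by auto
  ultimately have "k = 0 \<or> k = len i j" "l = 0 \<or> l = len i' j'"
    using ij ij' by auto
  then show ?thesis
    using eq ij ij' pt_0[of i j] pt_0[of i' j'] pt_len[of i j] pt_len[of i' j']
      b_inj[of i i'] b_inj[of i j'] b_inj[of j i'] b_inj[of j j'] by auto
qed

lemma b_adj_b_if_len_1: "\<lbrakk>i < 4; j < 4; i \<noteq> j; len i j = 1\<rbrakk> \<Longrightarrow> E (b i) (b j)"
  using edge[of i j 0] pt_0[of i j] pt_len[of i j] by simp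

text \<open>The map \<open>vert\<close> from names to vertices is shown to be a bijection from the
  valid names onto \<open>V\<close> that matches \<open>link\<close> with \<open>E\<close>; the
  layout is then transported along it.\<close>

lemma shared_unsubdivided_imp_restricted_frame_graph:
  assumes triangle_free: "triangle_free V E"
    and acd: "a < 4" "c < 4" "d < 4" "a \<noteq> c" "a \<noteq> d" "c \<noteq> d"
    and unsubdivided: "len a c = 1" "len a d = 1"
  shows "restricted_frame_graph V E"
proof -
  obtain e where "{..<4} - {a, c, d} = {e}"
    using card_1_singletonE[of "{..<4} - {a, c, d}"] acd by (auto simp: card_Diff_subset)
  then have e: "e < 4" "e \<noteq> a" "e \<noteq> c" "e \<noteq> d" and all: "\<And>i. i < 4 \<Longrightarrow> i \<in> {a, c, d, e}"
    by auto
  note pairs = acd e acd(4-6)[symmetric] e(2-4)[symmetric]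
  define p q n m where "p = len e c" and "q = len e d" and "n = len e a" and "m = len d c"
  have no_triangle: "\<not> (len i j = 1 \<and> len j k = 1 \<and> len i k = 1)"
    if "i < 4" "j < 4" "k < 4" "i \<noteq> j" "j \<noteq> k" "i \<noteq> k" for i j k
    using that triangle_free b_adj_b_if_len_1 b_in_V unfolding triangle_free_def by metis
  define hh aa where "hh = int p + int q + int n + int m + 5" and "aa = 2 * hh + 10"
  have "0 < p" "0 < q" "0 < n" "0 < m"
    using len_pos[of e c] len_pos[of e d] len_pos[of e a] len_pos[of d c]
    by (simp_all add: pairs p_def q_def n_def m_def)
  \<comment> \<open>Excludes the triangle on \<open>a\<close>, \<open>c\<close>, \<open>d\<close>;
    the next fact excludes those on \<open>e\<close>, \<open>a\<close> and one of \<open>c\<close>,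
    \<open>d\<close>.\<close>
  moreover have "m \<noteq> 1"
    using no_triangle[of a d c] unsubdivided by (simp add: pairs m_def)
  moreover have "p \<noteq> 1 \<and> q \<noteq> 1" if "n = 1"
    using no_triangle[of e a c] no_triangle[of e a d] unsubdivided that
    by (simp add: pairs p_def q_def n_def)
  ultimately interpret frame_layout p q n m hh aa
    by unfold_locales (auto simp: hh_def aa_def)
  define vert where "vert x = (case x of Hub \<Rightarrow> b a | Cpos k \<Rightarrow> pt e c k | Dpos k \<Rightarrow> pt e d k
     | Apos k \<Rightarrow> pt e a k | Upos k \<Rightarrow> pt d c k)" for x
  have ends: "pt e c p = b c" "pt e d q = b d" "pt e a n = b a" "pt d c m = b c"
    "pt e c 0 = b e" "pt e d 0 = b e" "pt e a 0 = b e" "pt d c 0 = b d"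
    using pt_len[of e c] pt_len[of e d] pt_len[of e a] pt_len[of d c]
      pt_0[of e c] pt_0[of e d] pt_0[of e a] pt_0[of d c]
    by (simp_all add: pairs p_def q_def n_def m_def)
  have edges: "k < p \<Longrightarrow> E (pt e c k) (pt e c (Suc k))" "k < q \<Longrightarrow> E (pt e d k) (pt e d (Suc k))"
    "k < n \<Longrightarrow> E (pt e a k) (pt e a (Suc k))" "k < m \<Longrightarrow> E (pt d c k) (pt d c (Suc k))" for k
    using edge[of e c] edge[of e d] edge[of e a] edge[of d c]
    by (simp_all add: pairs p_def q_def n_def m_def)
  have hub_edges: "E (b a) (b c)" "E (b a) (b d)"
    using b_adj_b_if_len_1[of a c] b_adj_b_if_len_1[of a d] unsubdivided by (simp_all add: pairs)
  have link_E: "E (vert x) (vert y)" if "valid' x" "valid' y" "link' x y" for x y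
  proof -
    have first: "E (b e) (pt e c (Suc 0))" "E (b e) (pt e d (Suc 0))" "E (b e) (pt e a (Suc 0))"
      "E (b d) (pt d c (Suc 0))"
      using edges[of 0] ends lengths by simp_all
    have last: "Suc k = n \<Longrightarrow> E (pt e a k) (b a)" "Suc k = m \<Longrightarrow> E (pt d c k) (b c)" for k
      using edges(3,4)[of k] ends by auto
    show ?thesis
      using that lengths
      by (cases x; cases y) (auto simp only: vert_def valid_def link.simps pos.case One_nat_def
        Suc_le_eq ends hub_edges first last intro: edges first last)
  qed
  have inj: "x = y" if "valid' x" "valid' y" "vert x = vert y" for x y
  proof -
    \<comment> \<open>Writing \<open>b a\<close> as the start of a path lets
      \<open>pt_eq_distinct_paths\<close> separate it from other vertices; each use picks a path
      different from the one compared.\<close>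
    have hub: "pt a c 0 = b a" "pt a d 0 = b a" "pt a e 0 = b a"
      using pt_0[of a c] pt_0[of a d] pt_0[of a e] by (simp_all add: pairs)
    note meet = pt_eq_distinct_paths[unfolded doubleton_eq_iff]
    have C: "0 < k \<Longrightarrow> k \<le> p \<Longrightarrow> 0 < l \<Longrightarrow> l \<le> q \<Longrightarrow> pt e c k \<noteq> pt e d l"
      "0 < k \<Longrightarrow> k \<le> p \<Longrightarrow> l < n \<Longrightarrow> pt e c k \<noteq> pt e a l"
      "0 < k \<Longrightarrow> k \<le> p \<Longrightarrow> 0 < l \<Longrightarrow> l < m \<Longrightarrow> pt e c k \<noteq> pt d c l"
      "0 < k \<Longrightarrow> k \<le> p \<Longrightarrow> pt e c k \<noteq> b a" for k l
      using meet[of e c k e d l] meet[of e c k e a l] meet[of e c k d c l] meet[of e c k a d 0]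
      by (auto simp: pairs hub p_def q_def n_def m_def)
    have D: "0 < k \<Longrightarrow> k \<le> q \<Longrightarrow> l < n \<Longrightarrow> pt e d k \<noteq> pt e a l"
      "0 < k \<Longrightarrow> k \<le> q \<Longrightarrow> 0 < l \<Longrightarrow> l < m \<Longrightarrow> pt e d k \<noteq> pt d c l"
      "0 < k \<Longrightarrow> k \<le> q \<Longrightarrow> pt e d k \<noteq> b a" for k l
      using meet[of e d k e a l] meet[of e d k d c l] meet[of e d k a c 0]
      by (auto simp: pairs hub q_def n_def m_def)
    have A: "k < n \<Longrightarrow> l < m \<Longrightarrow> pt e a k \<noteq> pt d c l" "k < n \<Longrightarrow> pt e a k \<noteq> b a"
      "l < m \<Longrightarrow> pt d c l \<noteq> b a" for k l
      using meet[of e a k d c l] meet[of e a k a c 0] meet[of d c l a e 0]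
      by (auto simp: pairs hub n_def m_def)
    note distinct_paths = C D A C[THEN not_sym] D[THEN not_sym] A[THEN not_sym]
    show ?thesis
    proof (cases x; cases y)
      fix k l
      assume "x = Cpos k" "y = Cpos l"
      then show ?thesis
        using that pt_inj[of e c k l] by (simp add: pairs vert_def valid_def p_def)
    next
      fix k l
      assume "x = Dpos k" "y = Dpos l"
      then show ?thesis
        using that pt_inj[of e d k l] by (simp add: pairs vert_def valid_def q_def)
    next
      fix k l
      assume "x = Apos k" "y = Apos l"
      then show ?thesis
        using that pt_inj[of e a k l] by (simp add: pairs vert_def valid_def n_def)
    next
      fix k l
      assume "x = Upos k" "y = Upos l"
      then show ?thesis
        using that pt_inj[of d c k l] by (simp add: pairs vert_def valid_def m_def)
    qed (use that in \<open>simp_all add: vert_def valid_def distinct_paths\<close>)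
  qed
  \<comment> \<open>Every edge of the path comes from a link. This is checked for one orientation of
    each of the six paths and gives surjectivity on edges and vertices.\<close>
  define covered where "covered i j \<longleftrightarrow> (\<forall>k<len i j. \<exists>x y. valid' x \<and> valid' y \<and>
      (link' x y \<or> link' y x) \<and> pt i j k = vert x \<and> pt i j (Suc k) = vert y)" for i j
  have covered_sym: "covered j i" if ij: "i < 4" "j < 4" "i \<noteq> j" "covered i j" for i j
    unfolding covered_def
  proof (intro allI impI)
    fix k
    assume "k < len j i"
    then have k: "k < len i j"
      using len_sym ij by simp
    define k' where "k' = len i j - Suc k"
    have k': "k' < len i j" "len i j - k = Suc k'"
      using k by (auto simp: k'_def)
    obtain x y where "valid' x" "valid' y" "link' x y \<or> link' y x"
      "pt i j k' = vert x" "pt i j (Suc k') = vert y"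
      using ij(4) k'(1) unfolding covered_def by blast
    moreover have "pt j i k = pt i j (Suc k')" "pt j i (Suc k) = pt i j k'"
      using pt_sym[of i j k] pt_sym[of i j "Suc k"] k k' ij by (auto simp: k'_def)
    ultimately show "\<exists>x y. valid' x \<and> valid' y \<and> (link' x y \<or> link' y x) \<and>
        pt j i k = vert x \<and> pt j i (Suc k) = vert y"
      by metis
  qed
  have "covered e c"
    unfolding covered_def
  proof (intro allI impI)
    fix k
    assume "k < len e c"
    then show "\<exists>x y. valid' x \<and> valid' y \<and> (link' x y \<or> link' y x) \<and>
        pt e c k = vert x \<and> pt e c (Suc k) = vert y"
      using lengths ends
      \<comment> \<open>The vertex \<open>e\<close> has the single valid name \<open>Apos 0\<close>,
        so the first position needs its own case.\<close>
      by (intro exI[of _ "if k = 0 then Apos 0 else Cpos k"] exI[of _ "Cpos (Suc k)"])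
        (auto simp: valid_def vert_def p_def)
  qed
  moreover have "covered e d"
    unfolding covered_def
  proof (intro allI impI)
    fix k
    assume "k < len e d"
    then show "\<exists>x y. valid' x \<and> valid' y \<and> (link' x y \<or> link' y x) \<and>
        pt e d k = vert x \<and> pt e d (Suc k) = vert y"
      using lengths ends
      by (intro exI[of _ "if k = 0 then Apos 0 else Dpos k"] exI[of _ "Dpos (Suc k)"])
        (auto simp: valid_def vert_def q_def)
  qed
  moreover have "covered e a"
    unfolding covered_def
  proof (intro allI impI)
    fix k
    assume "k < len e a"
    then show "\<exists>x y. valid' x \<and> valid' y \<and> (link' x y \<or> link' y x) \<and>
        pt e a k = vert x \<and> pt e a (Suc k) = vert y"
      using lengths ends
      by (intro exI[of _ "Apos k"] exI[of _ "if Suc k = n then Hub else Apos (Suc k)"])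
        (auto simp: valid_def vert_def n_def)
  qed
  moreover have "covered d c"
    unfolding covered_def
  proof (intro allI impI)
    fix k
    assume "k < len d c"
    then show "\<exists>x y. valid' x \<and> valid' y \<and> (link' x y \<or> link' y x) \<and>
        pt d c k = vert x \<and> pt d c (Suc k) = vert y"
      using lengths ends
      \<comment> \<open>The ends \<open>d\<close> and \<open>c\<close> of this path are named as the
        ends of the chains from \<open>e\<close>.\<close>
      by (intro exI[of _ "if k = 0 then Dpos q else Upos k"] exI[of _ "if Suc k = m then Cpos p else Upos (Suc k)"])
        (auto simp: valid_def vert_def m_def)
  qed
  moreover have "covered a c"
    unfolding covered_def
    using lengths ends unsubdivided pt_0[of a c] pt_len[of a c]
    by (intro allI impI exI[of _ Hub] exI[of _ "Cpos p"]) (simp add: pairs valid_def vert_def)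
  moreover have "covered a d"
    unfolding covered_def
    using lengths ends unsubdivided pt_0[of a d] pt_len[of a d]
    by (intro allI impI exI[of _ Hub] exI[of _ "Dpos q"]) (simp add: pairs valid_def vert_def)
  ultimately have "\<forall>i\<in>{a, c, d, e}. \<forall>j\<in>{a, c, d, e}. i \<noteq> j \<longrightarrow> covered i j"
    using covered_sym[of e c] covered_sym[of e d] covered_sym[of e a] covered_sym[of d c]
      covered_sym[of a c] covered_sym[of a d] by (simp add: pairs)
  then have covered: "covered i j" if "i < 4" "j < 4" "i \<noteq> j" for i j
    using all that by blast
  have E_link: "\<exists>x y. valid' x \<and> valid' y \<and> (link' x y \<or> link' y x) \<and> u = vert x \<and> v = vert y"
    if "E u v" for u v
    using that covered unfolding E_iff covered_def by blast
  have V_vert: "\<exists>x. valid' x \<and> v = vert x" if "v \<in> V" for v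
  proof -
    obtain i j k where *: "i < 4" "j < 4" "i \<noteq> j" "k \<le> len i j" "v = pt i j k"
      using \<open>v \<in> V\<close> V_iff by blast
    show ?thesis
    proof (cases "k < len i j")
      case True
      then show ?thesis
        using covered * unfolding covered_def by blast
    next
      case False
      \<comment> \<open>The last vertex of a path starts no edge of it, so it is taken as the second
        end of the last edge.\<close>
      then have "k - 1 < len i j" "k = Suc (k - 1)"
        using * len_pos[of i j] by auto
      then show ?thesis
        using covered[OF *(1-3)] *(5) unfolding covered_def by metis
    qed
  qed
  \<comment> \<open>By injectivity of \<open>vert\<close> on valid names the description is unique
    for each vertex of the graph.\<close>
  define F where "F v = frame' (THE x. valid' x \<and> v = vert x)" for v
  have F: "F (vert x) = frame' x" if "valid' x" for x
    unfolding F_def using inj that by (intro arg_cong[of _ _ frame'] the_equality) auto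
  show ?thesis
  proof (rule restricted_frame_graphI[of E V F])
    show "E v u" if "E u v" for u v
      using that by (rule E_sym)
    show "frame_ok (F v)" if "v \<in> V" for v
      using V_vert[OF that] F frame_at_ok by auto
    show "pokes (F u) (F v) \<or> pokes (F v) (F u)" if "E u v" for u v
      using E_link[OF that] F link_imp_pokes by metis
    show "inside (F u) (F v) \<or> inside (F v) (F u) \<or> apart (F u) (F v)"
      if uv: "u \<in> V" "v \<in> V" "u \<noteq> v" "\<not> E u v" for u v
    proof -
      obtain x y where *: "valid' x" "valid' y" "u = vert x" "v = vert y"
        using V_vert[OF uv(1)] V_vert[OF uv(2)] by blast
      then have "x \<noteq> y" "\<not> link' x y" "\<not> link' y x"
        using uv link_E E_sym by blast+
      then show ?thesis
        using not_link_imp_apart_or_nested * F by simp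
    qed
    show "xr (F u) < xr (F w)"
      if uvw: "u \<in> V" "v \<in> V" "w \<in> V" "w \<noteq> u" "pokes (F v) (F u)" "inside (F w) (F v)" for u v w
    proof -
      obtain x y z where "valid' x" "valid' y" "valid' z" "u = vert x" "v = vert y" "w = vert z"
        using V_vert[OF uvw(1)] V_vert[OF uvw(2)] V_vert[OF uvw(3)] by blast
      then show ?thesis
        using inside_poking_frame[of x y z] F uvw by auto
    qed
  qed
qed

end

section \<open>The characterisation\<close>

text \<open>A witness constrains \<open>P i j\<close> only for \<open>i < j\<close>;
  \<open>min\<close> and \<open>max\<close> make the notion symmetric. Edges are counted, hence the
  subtraction of 1.\<close>

definition path_len :: "(nat \<Rightarrow> nat \<Rightarrow> 'a list) \<Rightarrow> nat \<Rightarrow> nat \<Rightarrow> nat" where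
  "path_len P i j = length (P (min i j) (max i j)) - 1"

definition path_pt :: "(nat \<Rightarrow> nat \<Rightarrow> 'a list) \<Rightarrow> nat \<Rightarrow> nat \<Rightarrow> nat \<Rightarrow> 'a" where
  "path_pt P i j k = P (min i j) (max i j) ! (if i < j then k else path_len P i j - k)"

lemma nth_in_interior: "\<lbrakk>0 < k; Suc k < length xs\<rbrakk> \<Longrightarrow> xs ! k \<in> interior xs"
  using nth_mem[of "k - 1" "butlast (tl xs)"] by (simp add: interior_def nth_butlast nth_tl)

text \<open>Passes from lists to the symmetric interface, so that the graph arguments may traverse a
  path in either direction.\<close>

lemma k4_paths_of_wit:
  assumes wit: "k4_subdivision_wit V E b P"
  shows "k4_paths V E b (path_len P) (path_pt P)"
proof -
  define W where "W i j = P (min i j) (max i j)" for i j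
  have W_sym: "W j i = W i j" for i j
    by (simp add: W_def min.commute max.commute)
  have mm: "(min i j, max i j) \<in> k4_pairs" if "i < 4" "j < 4" "i \<noteq> j" for i j
    using that by (auto simp: k4_pairs_def min_def max_def)
  have b_inj: "inj_on b {0..<4}"
    using wit by (simp add: k4_subdivision_wit_def)
  have W: "distinct (W i j)" "2 \<le> length (W i j)" "hd (W i j) = b (min i j)" "last (W i j) = b (max i j)"
    "interior (W i j) \<inter> b ` {0..<4} = {}" if "i < 4" "j < 4" "i \<noteq> j" for i j
    using wit mm[OF that] unfolding k4_subdivision_wit_def W_def by fast+
  have disj: "interior (W i j) \<inter> set (W k l) = {}"
    if "i < 4" "j < 4" "i \<noteq> j" "k < 4" "l < 4" "k \<noteq> l" "{i, j} \<noteq> {k, l}" for i j k l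
  proof -
    have "(min i j, max i j) \<noteq> (min k l, max k l)"
      using that(7) by (auto simp: min_def max_def split: if_splits)
    then show ?thesis
      using wit mm[OF that(1-3)] mm[OF that(4-6)] unfolding k4_subdivision_wit_def W_def by fast
  qed
  have len: "Suc (path_len P i j) = length (W i j)" if "i < 4" "j < 4" "i \<noteq> j" for i j
    using W(2)[OF that] by (simp add: path_len_def W_def)
  have mem: "path_pt P i j k \<in> set (W i j)" if "i < 4" "j < 4" "i \<noteq> j" "k \<le> path_len P i j" for i j k
    using len[OF that(1-3)] that(4) by (auto simp: path_pt_def W_def[symmetric])
  have int: "path_pt P i j k \<in> interior (W i j)"
    if "i < 4" "j < 4" "i \<noteq> j" "0 < k" "k < path_len P i j" for i j k
    using len[OF that(1-3)] that(4,5) unfolding path_pt_def W_def[symmetric]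
    by (auto intro!: nth_in_interior)
  have forward: "path_pt P i j k = P i j ! k" "path_len P i j = length (P i j) - 1" if "i < j" for i j k
    using that by (simp_all add: path_pt_def path_len_def)
  have lsym: "path_len P j i = path_len P i j" for i j
    by (simp add: path_len_def min.commute max.commute)
  have sym: "path_pt P j i k = path_pt P i j (path_len P i j - k)"
    if "i \<noteq> j" "k \<le> path_len P i j" for i j k
    using that lsym[of i j] W_sym[of i j] by (auto simp: path_pt_def W_def[symmetric])
  show ?thesis
  proof
    show "i = j" if "i < 4" "j < 4" "b i = b j" for i j
      using b_inj that by (auto simp: inj_on_def)
    show "0 < path_len P i j" if "i < 4" "j < 4" "i \<noteq> j" for i j
      using len[OF that] W(2)[OF that] by simp
    show "path_len P j i = path_len P i j" for i j
      by (rule lsym)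
    show "path_pt P j i k = path_pt P i j (path_len P i j - k)"
      if "i < 4" "j < 4" "i \<noteq> j" "k \<le> path_len P i j" for i j k
      using sym that by blast
    show "path_pt P i j 0 = b i" if "i < 4" "j < 4" "i \<noteq> j" for i j
    proof -
      have "W i j \<noteq> []"
        using W(2)[OF that] by auto
      then show ?thesis
        using W(3,4)[OF that] len[OF that, symmetric] that(3)
        unfolding path_pt_def W_def[symmetric]
        by (cases "i < j") (auto simp: hd_conv_nth last_conv_nth)
    qed
    show "k = l" if "i < 4" "j < 4" "i \<noteq> j" "k \<le> path_len P i j" "l \<le> path_len P i j"
        "path_pt P i j k = path_pt P i j l" for i j k l
    proof -
      have "(if i < j then k else path_len P i j - k) = (if i < j then l else path_len P i j - l)"
        using that(4-6) len[OF that(1-3), symmetric]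
        unfolding path_pt_def W_def[symmetric]
        by (intro iffD1[OF nth_eq_iff_index_eq[OF W(1)[OF that(1-3)]]]) auto
      then show ?thesis
        using that(4,5) by (auto split: if_splits)
    qed
    show "path_pt P i j k \<noteq> b l"
      if "i < 4" "j < 4" "i \<noteq> j" "0 < k" "k < path_len P i j" "l < 4" for i j k l
      using int[OF that(1-5)] W(5)[OF that(1-3)] that(6) by force
    show "{i, j} = {i', j'}"
      if "i < 4" "j < 4" "i \<noteq> j" "0 < k" "k < path_len P i j"
        "i' < 4" "j' < 4" "i' \<noteq> j'" "l \<le> path_len P i' j'" "path_pt P i j k = path_pt P i' j' l" for i j k i' j' l
      using int[OF that(1-5)] mem[OF that(6-9)] disj[OF that(1-3,6-8)] that(10) by auto
    show "v \<in> V \<longleftrightarrow> (\<exists>i j k. i < 4 \<and> j < 4 \<and> i \<noteq> j \<and> k \<le> path_len P i j \<and> v = path_pt P i j k)" for v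
    proof
      assume "v \<in> V"
      then obtain i j where ij: "(i, j) \<in> k4_pairs" "v \<in> set (P i j)"
        using wit by (auto simp: k4_subdivision_wit_def)
      then obtain k where "k < length (P i j)" "v = P i j ! k"
        by (auto simp: in_set_conv_nth)
      then show "\<exists>i j k. i < 4 \<and> j < 4 \<and> i \<noteq> j \<and> k \<le> path_len P i j \<and> v = path_pt P i j k"
        using ij forward[of i j] by (intro exI[of _ i] exI[of _ j] exI[of _ k]) (auto simp: k4_pairs_def)
    next
      assume "\<exists>i j k. i < 4 \<and> j < 4 \<and> i \<noteq> j \<and> k \<le> path_len P i j \<and> v = path_pt P i j k"
      then obtain i j where "i < 4" "j < 4" "i \<noteq> j" "v \<in> set (W i j)"
        using mem by blast
      then show "v \<in> V"
        using wit mm[of i j] unfolding k4_subdivision_wit_def W_def by blast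
    qed
    show "E u v \<longleftrightarrow> (\<exists>i j k. i < 4 \<and> j < 4 \<and> i \<noteq> j \<and> k < path_len P i j \<and>
        u = path_pt P i j k \<and> v = path_pt P i j (Suc k))" for u v
    proof -
      have E: "E u v \<longleftrightarrow> (\<exists>(i, j) \<in> k4_pairs. \<exists>k. Suc k < length (P i j) \<and>
            ((u = P i j ! k \<and> v = P i j ! Suc k) \<or> (v = P i j ! k \<and> u = P i j ! Suc k)))" for u v
        using wit by (simp add: k4_subdivision_wit_def)
      have E_sym: "E u v \<Longrightarrow> E v u" for u v
        unfolding E by blast
      show ?thesis
      proof
        assume "E u v"
        then obtain i j k where *: "(i, j) \<in> k4_pairs" "Suc k < length (P i j)"
          "u = P i j ! k \<and> v = P i j ! Suc k \<or> v = P i j ! k \<and> u = P i j ! Suc k"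
          unfolding E by blast
        then have ij: "i < 4" "j < 4" "i < j"
          by (auto simp: k4_pairs_def)
        have kl: "k < path_len P i j" "k < path_len P j i"
          using *(2) forward(2)[OF ij(3)] lsym by auto
        from *(3) show "\<exists>i j k. i < 4 \<and> j < 4 \<and> i \<noteq> j \<and> k < path_len P i j \<and>
          u = path_pt P i j k \<and> v = path_pt P i j (Suc k)"
        proof
          assume "u = P i j ! k \<and> v = P i j ! Suc k"
          then show ?thesis
            using ij kl forward(1)[OF ij(3)] by (metis less_irrefl)
        next
          assume uv: "v = P i j ! k \<and> u = P i j ! Suc k"
          \<comment> \<open>Traversed backwards, the edge starting at position \<open>k\<close>
            starts at position \<open>?k\<close>.\<close>
          let ?k = "path_len P i j - Suc k"
          have "u = path_pt P j i ?k" "v = path_pt P j i (Suc ?k)"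
            using uv sym[of i j ?k] sym[of i j "Suc ?k"] kl forward(1)[OF ij(3)] ij by auto
          moreover have "?k < path_len P j i"
            using kl lsym[of i j] by simp
          ultimately show ?thesis
            using ij by (metis less_irrefl)
        qed
      next
        assume "\<exists>i j k. i < 4 \<and> j < 4 \<and> i \<noteq> j \<and> k < path_len P i j \<and>
          u = path_pt P i j k \<and> v = path_pt P i j (Suc k)"
        then obtain i j k where *: "i < 4" "j < 4" "i \<noteq> j" "k < path_len P i j"
          "u = path_pt P i j k" "v = path_pt P i j (Suc k)"
          by blast
        show "E u v"
        proof (cases "i < j")
          case True
          then have "(i, j) \<in> k4_pairs" "Suc k < length (P i j)" "u = P i j ! k" "v = P i j ! Suc k"
            using * forward[OF True] by (auto simp: k4_pairs_def)
          then show ?thesis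
            unfolding E by blast
        next
          case False
          then have ji: "j < i"
            using * by simp
          let ?k = "path_len P j i - Suc k"
          have "Suc ?k = path_len P j i - k"
            using * lsym[of i j] by simp
          then have "(j, i) \<in> k4_pairs" "Suc ?k < length (P j i)" "v = P j i ! ?k" "u = P j i ! Suc ?k"
            using * sym[of j i k] sym[of j i "Suc k"] forward[OF ji] lsym[of i j] ji
            by (auto simp: k4_pairs_def)
          then show ?thesis
            unfolding E by blast
        qed
      qed
    qed
  qed
qed

section \<open>Matchings in K4 and the number of subdivided edges\<close>

lemma k4_pairs_eq: "k4_pairs = {(0, 1), (0, 2), (0, 3), (1, 2), (1, 3), (2, 3)}"
proof -
  have "i < j \<and> j < 4 \<longleftrightarrow> (i, j) \<in> {(0, 1), (0, 2), (0, 3), (1, 2), (1, 3), (2, 3)}" for i j :: nat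
    by auto
  then show ?thesis
    unfolding k4_pairs_def by auto
qed

definition pairs_disjoint :: "(nat \<times> nat) set \<Rightarrow> bool" where
  "pairs_disjoint A \<longleftrightarrow> (\<forall>p\<in>A. \<forall>q\<in>A. p \<noteq> q \<longrightarrow> {fst p, snd p} \<inter> {fst q, snd q} = {})"

text \<open>Each edge of K4 has exactly one edge disjoint from it.\<close>

lemma pairs_disjoint_imp_card_le_2:
  assumes "A \<subseteq> k4_pairs" "pairs_disjoint A"
  shows "card A \<le> 2"
proof -
  have "card A \<le> 2" if "x \<in> A" for x
  proof -
    have "x \<in> k4_pairs" "A \<subseteq> {y \<in> k4_pairs. y = x \<or> {fst x, snd x} \<inter> {fst y, snd y} = {}}"
      using assms that unfolding pairs_disjoint_def by auto
    then obtain y where "A \<subseteq> {x, y}"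
      unfolding k4_pairs_eq by (elim insertE emptyE) fastforce+
    then have "card A \<le> card {x, y}"
      by (intro card_mono) auto
    also have "\<dots> \<le> 2"
      by (simp add: card_insert_if)
    finally show ?thesis .
  qed
  then show ?thesis
    by (cases "A = {}") auto
qed

text \<open>A matching has at most two of the six edges. So with at most three subdivided edges the
  unsubdivided ones are no matching, and with four subdivided edges it depends on whether the
  remaining two meet.\<close>

lemma few_subdivided_iff_not_pairs_disjoint:
  "card (subdivided_pairs P) \<le> 3 \<or> card (subdivided_pairs P) = 4 \<and>
     (\<forall>p \<in> k4_pairs - subdivided_pairs P. \<forall>q \<in> k4_pairs - subdivided_pairs P.
        {fst p, snd p} \<inter> {fst q, snd q} \<noteq> {}) \<longleftrightarrow>
   \<not> pairs_disjoint (k4_pairs - subdivided_pairs P)"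
proof -
  define U where "U = k4_pairs - subdivided_pairs P"
  have "subdivided_pairs P \<subseteq> k4_pairs" "finite k4_pairs" "card k4_pairs = 6"
    by (auto simp: subdivided_pairs_def k4_pairs_eq)
  then have card: "card U + card (subdivided_pairs P) = 6" "finite U" "U \<subseteq> k4_pairs"
    unfolding U_def using card_mono[of k4_pairs "subdivided_pairs P"]
    by (auto simp: card_Diff_subset finite_subset)
  have pair: "U = {x, y}" if "card U \<le> 2" "x \<in> U" "y \<in> U" "x \<noteq> y" for x y
    using that card(2) by (intro card_seteq[symmetric]) auto
  show ?thesis
    unfolding U_def[symmetric]
  proof
    assume few: "card (subdivided_pairs P) \<le> 3 \<or> card (subdivided_pairs P) = 4 \<and>
      (\<forall>p\<in>U. \<forall>q\<in>U. {fst p, snd p} \<inter> {fst q, snd q} \<noteq> {})"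
    show "\<not> pairs_disjoint U"
    proof
      assume disj: "pairs_disjoint U"
      then have "card U = 2" "\<forall>p\<in>U. \<forall>q\<in>U. {fst p, snd p} \<inter> {fst q, snd q} \<noteq> {}"
        using pairs_disjoint_imp_card_le_2[OF card(3)] few card(1) by auto
      then show False
        using disj unfolding pairs_disjoint_def card_2_iff by blast
    qed
  next
    assume "\<not> pairs_disjoint U"
    then obtain x y where xy: "x \<in> U" "y \<in> U" "x \<noteq> y" "{fst x, snd x} \<inter> {fst y, snd y} \<noteq> {}"
      unfolding pairs_disjoint_def by blast
    show "card (subdivided_pairs P) \<le> 3 \<or> card (subdivided_pairs P) = 4 \<and>
      (\<forall>p\<in>U. \<forall>q\<in>U. {fst p, snd p} \<inter> {fst q, snd q} \<noteq> {})"
    proof (cases "card U \<le> 2")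
      case True
      then have "U = {x, y}"
        using pair xy by blast
      moreover from this have "card U = 2"
        using xy by simp
      ultimately show ?thesis
        using card(1) xy(4) by auto
    next
      case False
      then show ?thesis
        using card(1) by simp
    qed
  qed
qed

theorem theoremA1:
  fixes V :: "'a set" and E :: "'a \<Rightarrow> 'a \<Rightarrow> bool"
  assumes "simple_graph V E"
    and "k4_subdivision V E"
    and "triangle_free V E"
  shows "restricted_frame_graph V E \<longleftrightarrow>
    ((\<exists>b P. k4_subdivision_wit V E b P \<and> card (subdivided_pairs P) \<le> 3) \<or>
     (\<exists>b P. k4_subdivision_wit V E b P \<and> card (subdivided_pairs P) = 4 \<and>
        (\<forall>p \<in> k4_pairs - subdivided_pairs P. \<forall>q \<in> k4_pairs - subdivided_pairs P.
           {fst p, snd p} \<inter> {fst q, snd q} \<noteq> {})))"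
proof -
  \<comment> \<open>Proved for an arbitrary witness, because the witnesses in the two alternatives
    may differ from each other and from the one supplied by the assumption.\<close>
  have iff: "restricted_frame_graph V E \<longleftrightarrow> \<not> pairs_disjoint (k4_pairs - subdivided_pairs P)"
    if wit: "k4_subdivision_wit V E b P" for b P
  proof -
    interpret k4_paths V E b "path_len P" "path_pt P"
      using k4_paths_of_wit[OF wit] .
    define U where "U = k4_pairs - subdivided_pairs P"
    have len2: "2 \<le> length (P i j)" if "i < j" "j < 4" for i j
      using wit that unfolding k4_subdivision_wit_def k4_pairs_def by auto
    have U_iff: "(min i j, max i j) \<in> U \<longleftrightarrow> path_len P i j = 1" if "i < 4" "j < 4" "i \<noteq> j" for i j
      using that len2[of i j] len2[of j i]
      by (auto simp: U_def subdivided_pairs_def k4_pairs_def path_len_def min_def max_def)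
    have U_pairs: "i < j \<and> j < 4" if "(i, j) \<in> U" for i j
      using that by (auto simp: U_def k4_pairs_def)
    show ?thesis
      unfolding U_def[symmetric]
    proof
      assume rfg: "restricted_frame_graph V E"
      show "\<not> pairs_disjoint U"
      proof
        assume disj: "pairs_disjoint U"
        have unsubdivided_matching
          unfolding unsubdivided_matching_def
        proof (intro allI impI)
          fix i j k :: nat
          assume *: "i < 4" "j < 4" "k < 4" "i \<noteq> j" "i \<noteq> k" "path_len P i j = 1" "path_len P i k = 1"
          then have "(min i j, max i j) \<in> U" "(min i k, max i k) \<in> U"
            using U_iff by auto
          moreover have "i \<in> {min i j, max i j} \<inter> {min i k, max i k}"
            by (auto simp: min_def max_def)
          ultimately have "(min i j, max i j) = (min i k, max i k)"
            using disj unfolding pairs_disjoint_def by (metis empty_iff fst_conv snd_conv)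
          then show "j = k"
            using * by (auto simp: min_def max_def split: if_splits)
        qed
        moreover have "subdivided_pairs P = {(i, j). i < j \<and> j < 4 \<and> 1 < path_len P i j}"
          by (auto simp: subdivided_pairs_def k4_pairs_def path_len_def)
        moreover have "4 \<le> card (subdivided_pairs P)"
          using few_subdivided_iff_not_pairs_disjoint[of P] disj unfolding U_def by auto
        ultimately show False
          using matching_not_restricted_frame_graph[OF assms(3)] rfg by simp
      qed
    next
      assume "\<not> pairs_disjoint U"
      then obtain x y where "x \<in> U" "y \<in> U" "x \<noteq> y" "{fst x, snd x} \<inter> {fst y, snd y} \<noteq> {}"
        unfolding pairs_disjoint_def by blast
      then obtain i j k l where xy: "(i, j) \<in> U" "(k, l) \<in> U" "(i, j) \<noteq> (k, l)" "{i, j} \<inter> {k, l} \<noteq> {}"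
        by (metis prod.collapse)
      have len_1: "i < 4" "j < 4" "i \<noteq> j" "path_len P i j = 1" "path_len P j i = 1"
        if "(i, j) \<in> U" for i j
        using U_pairs[OF that] U_iff[of i j] that len_sym[of i j] by (auto simp: min_def max_def)
      note rfg = shared_unsubdivided_imp_restricted_frame_graph[OF assms(3)]
      consider "i = k" "j \<noteq> l" | "i = l" "j \<noteq> k" | "j = k" "i \<noteq> l" | "j = l" "i \<noteq> k"
        using xy(3,4) U_pairs[OF xy(1)] U_pairs[OF xy(2)] by auto
      then show "restricted_frame_graph V E"
      proof cases
        case 1
        then show ?thesis
          using rfg[of i j l] len_1[OF xy(1)] len_1[OF xy(2)] by simp
      next
        case 2
        then show ?thesis
          using rfg[of i j k] len_1[OF xy(1)] len_1[OF xy(2)] by simp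
      next
        case 3
        then show ?thesis
          using rfg[of j i l] len_1[OF xy(1)] len_1[OF xy(2)] by simp
      next
        case 4
        then show ?thesis
          using rfg[of j i k] len_1[OF xy(1)] len_1[OF xy(2)] by simp
      qed
    qed
  qed
  obtain b P where "k4_subdivision_wit V E b P"
    using assms(2) unfolding k4_subdivision_def by blast
  then show ?thesis
    using iff few_subdivided_iff_not_pairs_disjoint by metis
qed

end
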